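(* Let $L$ be a finite-dimensional solvable restricted Lie algebra over an algebraically closed field of characteristic $p>0$. The following are equivalent: (i) $L$ is lower semimodular; (ii) $L$ is a $J$-algebra; (iii) $L$ is supersolvable.
   Context: All algebras are finite-dimensional. $\langle U,B\rangle_p$ denotes the restricted subalgebra generated by $U\cup B$, and "maximal" means maximal among proper restricted subalgebras. A restricted subalgebra $U$ of $L$ is lower semimodular in $L$ if $U\cap B$ is maximal in $B$ for every restricted subalgebra $B$ of $L$ such that $U$ is maximal in $\langle U,B\rangle_p$. $L$ is lower semimodular if every restricted subalgebra of $L$ is lower semimodular in $L$. If $U\subseteq V$ are restricted subalgebras of $L$, a $J$-series for $(U,V)$ is a series $U=U_0\subsetneq U_1\subsetneq\cdots\subsetneq U_r=V$ of restricted subalgebras such that $U_i$ is maximal in $U_{i+1}$ for $0\le i\le r-1$; its length is $r$. $L$ is a $J$-algebra if, whenever $U\subseteq V$ are restricted subalgebras of $L$, all $J$-series for $(U,V)$ have the same finite length. $L$ is supersolvable if there is a chain $0=L_0\subsetneq L_1\subsetneq\cdots\subsetneq L_n=L$ of (not necessarily restricted) ideals of $L$ with $\dim L_j=j$ for every $0\le j\le n$. *)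

theory Defs
  imports "HOL-Computational_Algebra.Computational_Algebra"
begin

text \<open>
  A Lie algebra is carried by a subspace \<open>L\<close> of an ambient vector space type, so that its
  subalgebras are Lie algebras in the same sense; \<open>L = UNIV\<close> is allowed. The operations are
  only constrained on \<open>L\<close>.
\<close>

locale lie_algebra = vector_space scale
  for scale :: "'k::field \<Rightarrow> 'v::ab_group_add \<Rightarrow> 'v" (infixr \<open>*s\<close> 75) +
  fixes L :: "'v set"
    and bracket :: "'v \<Rightarrow> 'v \<Rightarrow> 'v"
  assumes subspace_L: "subspace L"
    and bracket_closed: "\<lbrakk>x \<in> L; y \<in> L\<rbrakk> \<Longrightarrow> bracket x y \<in> L"
    and bracket_add_left:
      "\<lbrakk>x \<in> L; y \<in> L; z \<in> L\<rbrakk> \<Longrightarrow> bracket (x + y) z = bracket x z + bracket y z"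
    and bracket_add_right:
      "\<lbrakk>x \<in> L; y \<in> L; z \<in> L\<rbrakk> \<Longrightarrow> bracket x (y + z) = bracket x y + bracket x z"
    and bracket_scale_left: "\<lbrakk>x \<in> L; y \<in> L\<rbrakk> \<Longrightarrow> bracket (a *s x) y = a *s bracket x y"
    and bracket_scale_right: "\<lbrakk>x \<in> L; y \<in> L\<rbrakk> \<Longrightarrow> bracket x (a *s y) = a *s bracket x y"
    and bracket_self: "x \<in> L \<Longrightarrow> bracket x x = 0"
    and jacobi: "\<lbrakk>x \<in> L; y \<in> L; z \<in> L\<rbrakk> \<Longrightarrow>
      bracket x (bracket y z) + bracket y (bracket z x) + bracket z (bracket x y) = 0"
begin

definition finite_dimensional :: bool where
  "finite_dimensional \<longleftrightarrow> (\<exists>B. finite B \<and> span B = L)"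

definition ideal :: "'v set \<Rightarrow> bool" where
  "ideal I \<longleftrightarrow> I \<subseteq> L \<and> subspace I \<and> (\<forall>x\<in>L. \<forall>y\<in>I. bracket x y \<in> I)"

primrec derived_series :: "nat \<Rightarrow> 'v set" where
  "derived_series 0 = L"
| "derived_series (Suc n) =
     span {bracket x y | x y. x \<in> derived_series n \<and> y \<in> derived_series n}"

definition solvable :: bool where
  "solvable \<longleftrightarrow> (\<exists>n. derived_series n = {0})"

definition supersolvable :: bool where
  "supersolvable \<longleftrightarrow>
     (\<exists>(n::nat) C. C 0 = {0} \<and> C n = L \<and>
        (\<forall>j\<le>n. ideal (C j) \<and> dim (C j) = j) \<and> (\<forall>j<n. C j \<subset> C (Suc j)))"

text \<open>
  Elements of \<open>L \<otimes> k[X]\<close> are encoded as polynomials with coefficients in \<open>L\<close>; the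
  following is \<open>ad (x \<otimes> X + y \<otimes> 1)\<close>.
\<close>

definition ad_pencil :: "'v \<Rightarrow> 'v \<Rightarrow> 'v poly \<Rightarrow> 'v poly" where
  "ad_pencil x y w = pCons 0 (map_poly (bracket x) w) + map_poly (bracket y) w"

text \<open>
  Jacobson's Lie polynomials \<open>s\<^sub>i(x, y)\<close>, \<open>1 \<le> i < p\<close>, in characteristic \<open>p\<close>, determined by
  \<open>(ad (x \<otimes> X + y \<otimes> 1))\<^bsup>p-1\<^esup> (x \<otimes> 1) = (\<Sum>i=1..<p. i s\<^sub>i(x, y) \<otimes> X\<^bsup>i-1\<^esup>)\<close>.
\<close>

definition jacobson_poly :: "nat \<Rightarrow> 'v \<Rightarrow> 'v \<Rightarrow> 'v" where
  "jacobson_poly i x y =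
     inverse (of_nat i) *s coeff ((ad_pencil x y ^^ (CHAR('k) - 1)) [:x:]) (i - 1)"

end

locale restricted_lie_algebra = lie_algebra scale L bracket
  for scale :: "'k::field \<Rightarrow> 'v::ab_group_add \<Rightarrow> 'v" (infixr \<open>*s\<close> 75)
    and L :: "'v set"
    and bracket :: "'v \<Rightarrow> 'v \<Rightarrow> 'v" +
  fixes pmap :: "'v \<Rightarrow> 'v"
  assumes char_pos: "CHAR('k) > 0"
    and pmap_closed: "x \<in> L \<Longrightarrow> pmap x \<in> L"
    and ad_pmap: "\<lbrakk>x \<in> L; y \<in> L\<rbrakk> \<Longrightarrow> bracket (pmap x) y = (bracket x ^^ CHAR('k)) y"
    and pmap_scale: "x \<in> L \<Longrightarrow> pmap (a *s x) = a ^ CHAR('k) *s pmap x"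
    and pmap_add: "\<lbrakk>x \<in> L; y \<in> L\<rbrakk> \<Longrightarrow>
      pmap (x + y) = pmap x + pmap y + (\<Sum>i=1..<CHAR('k). jacobson_poly i x y)"
begin

definition restricted_subalgebra :: "'v set \<Rightarrow> bool" where
  "restricted_subalgebra U \<longleftrightarrow>
     U \<subseteq> L \<and> subspace U \<and> (\<forall>x\<in>U. \<forall>y\<in>U. bracket x y \<in> U) \<and> (\<forall>x\<in>U. pmap x \<in> U)"

definition maximal_in :: "'v set \<Rightarrow> 'v set \<Rightarrow> bool" where
  "maximal_in U V \<longleftrightarrow>
     restricted_subalgebra U \<and> restricted_subalgebra V \<and> U \<subset> V \<and>
     \<not> (\<exists>W. restricted_subalgebra W \<and> U \<subset> W \<and> W \<subset> V)"

definition lower_semimodular_in :: "'v set \<Rightarrow> bool" where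
  "lower_semimodular_in U \<longleftrightarrow>
     (\<forall>B. restricted_subalgebra B \<longrightarrow>
        maximal_in U (restricted_subalgebra hull (U \<union> B)) \<longrightarrow> maximal_in (U \<inter> B) B)"

definition lower_semimodular :: bool where
  "lower_semimodular \<longleftrightarrow> (\<forall>U. restricted_subalgebra U \<longrightarrow> lower_semimodular_in U)"

text \<open>\<open>J_series U V r C\<close>: the sets \<open>C 0, \<dots>, C r\<close> form a $J$-series for \<open>(U, V)\<close> of length \<open>r\<close>.\<close>

definition J_series :: "'v set \<Rightarrow> 'v set \<Rightarrow> nat \<Rightarrow> (nat \<Rightarrow> 'v set) \<Rightarrow> bool" where
  "J_series U V r C \<longleftrightarrow>
     C 0 = U \<and> C r = V \<and> (\<forall>i\<le>r. restricted_subalgebra (C i)) \<and>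
     (\<forall>i<r. maximal_in (C i) (C (Suc i)))"

definition J_algebra :: bool where
  "J_algebra \<longleftrightarrow>
     (\<forall>U V. restricted_subalgebra U \<longrightarrow> restricted_subalgebra V \<longrightarrow> U \<subseteq> V \<longrightarrow>
        (\<exists>n. \<forall>r C. J_series U V r C \<longrightarrow> r = n))"

end

end

theory Submission
  imports Defs
begin

text \<open>
  All three conditions are equivalent to: a maximal restricted subalgebra \<open>U\<close> of a restricted
  subalgebra \<open>V\<close> always has codimension one in \<open>V\<close>. The basic source of codimension one is that if \<open>U\<close>
  is normalised by some \<open>y \<in> V - U\<close>, then \<open>V / U\<close> is abelian without proper restricted subalgebras,
  and the semilinear \<open>p\<close>-map has an eigenvector on it.

  If \<open>L\<close> is supersolvable, take \<open>x\<close> in the first ideal \<open>L\<^sub>j\<close> of the chain with \<open>L\<^sub>j \<inter> V\<close> not inside \<open>U\<close>: either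
  \<open>U + k x\<close> is restricted, or \<open>x\<^bsup>[p]\<^esup>\<close> normalises \<open>U\<close>. In a solvable algebra there always is a maximal
  restricted subalgebra of codimension one (above the derived algebra), which gives the implication
  from a \<open>J\<close>-algebra and from lower semimodularity by comparison.

  Conversely, if maximal means codimension one, let \<open>V\<close> be a minimal subalgebra which is not
  supersolvable. Every proper \<open>K\<close> acts triangularly on \<open>V\<close>, since it does so on \<open>K\<close> and on \<open>V / K\<close>. Let
  \<open>M\<close> contain the derived algebra of \<open>V\<close> and have codimension one, and let \<open>B / A\<close> be a chief factor of
  \<open>V\<close>. Then \<open>[M, M]\<close> annihilates \<open>B / A\<close>, and if a commutator \<open>c = [v, w]\<close> did not, its Fitting null
  component \<open>K\<close> would be a proper restricted subalgebra with \<open>V = K + [M, M]\<close>. So \<open>c\<close> would agree on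
  \<open>B / A\<close> with a commutator of elements of \<open>K\<close>, which is nilpotent: a contradiction. Hence \<open>V\<close> acts on
  \<open>B / A\<close> through commuting operators, and \<open>B / A\<close> is one-dimensional.
\<close>

section \<open>Eigenvectors modulo a subspace\<close>

context vector_space
begin

section \<open>Dimension counts inside a finitely generated span\<close>

lemma span_of_subspace: "subspace S \<Longrightarrow> span S = S"
  by simp

lemma mem_span_insert_subspace:
  "subspace S \<Longrightarrow> y \<in> span (insert x S) \<longleftrightarrow> (\<exists>k. y - k *s x \<in> S)"
  by (simp add: span_breakdown_eq span_of_subspace)

lemma span_insert_subset: "subspace T \<Longrightarrow> x \<in> T \<Longrightarrow> S \<subseteq> T \<Longrightarrow> span (insert x S) \<subseteq> T"
  by (simp add: span_minimal)

text \<open>The finite set \<open>T\<close> keeps every basis involved finite; \<open>card\<close>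
  would be 0 on an infinite one.\<close>

lemma dim_span_insert:
  assumes "finite T" "x \<in> span T" "S \<subseteq> span T" "subspace S" "x \<notin> S"
  shows "dim (span (insert x S)) = Suc (dim S)"
proof -
  obtain B where B: "B \<subseteq> S" "independent B" "S \<subseteq> span B" "card B = dim S"
    using basis_exists by blast
  have fin: "finite B"
    using independent_span_bound[OF assms(1) B(2)] B(1) assms(3) by blast
  have sB: "span B = S"
    using B(1,3) assms(4) by (simp add: span_subspace)
  have ind: "independent (insert x B)"
    using B(2) assms(5) sB by (simp add: independent_insertI)
  have "span (insert x B) = span (insert x S)"
    unfolding span_insert sB using assms(4) by (simp add: span_of_subspace)
  then have "dim (insert x S) = card (insert x B)"
    using dim_eq_card ind by blast
  also have "\<dots> = Suc (dim S)"
    using fin B(1,4) assms(5) by (metis card_insert_disjoint in_mono)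
  finally show ?thesis by simp
qed

lemma dim_mono_finite:
  assumes "finite T" "S' \<subseteq> span T" "S \<subseteq> S'"
  shows "dim S \<le> dim S'"
proof -
  obtain B where B: "B \<subseteq> S'" "independent B" "S' \<subseteq> span B" "card B = dim S'"
    using basis_exists by blast
  have "finite B"
    using independent_span_bound[OF assms(1) B(2)] B(1) assms(2) by blast
  then show ?thesis
    using dim_le_card[of S B] B(3,4) assms(3) by auto
qed

lemma dim_strict_mono_finite:
  assumes "finite T" "S' \<subseteq> span T" "S \<subset> S'" "subspace S" "subspace S'"
  shows "dim S < dim S'"
proof -
  obtain x where x: "x \<in> S'" "x \<notin> S" using assms(3) by blast
  have "dim (span (insert x S)) = Suc (dim S)"
    using assms x by (intro dim_span_insert[of T]) auto
  moreover have "dim (span (insert x S)) \<le> dim S'"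
    using assms x by (intro dim_mono_finite[of T]) (auto simp: span_insert_subset)
  ultimately show ?thesis by simp
qed

lemma in_span_Un_image:
  assumes "subspace A" "x \<in> span (A \<union> v ` {..<n::nat})"
  shows "\<exists>a. x - (\<Sum>i<n. a i *s v i) \<in> A"
  using assms(2)
proof (induction n arbitrary: x)
  case 0
  then show ?case using assms(1) by (simp add: span_of_subspace)
next
  case (Suc n)
  then have "x \<in> span (insert (v n) (A \<union> v ` {..<n}))"
    by (simp add: lessThan_Suc)
  then obtain k where "x - k *s v n \<in> span (A \<union> v ` {..<n})"
    using span_breakdown_eq by blast
  then obtain a where a: "x - k *s v n - (\<Sum>i<n. a i *s v i) \<in> A"
    using Suc.IH by blast
  have eq: "x - (\<Sum>i<Suc n. (a(n := k)) i *s v i) = x - k *s v n - (\<Sum>i<n. a i *s v i)"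
    by simp
  show ?case by (rule exI[of _ "a(n := k)"]) (unfold eq, rule a)
qed

text \<open>The spaces spanned by \<open>A\<close> and \<open>v 0, ..., v (n - 1)\<close> stay in a
  finite-dimensional space, so they cannot grow forever. The first \<open>n\<close> at which
  \<open>v n\<close> brings nothing new gives the relation, and its being first gives independence
  modulo \<open>A\<close>. Since \<open>v 0\<close> is outside \<open>A\<close>, this
  \<open>n\<close> is a successor.\<close>

lemma first_relation:
  fixes v :: "nat \<Rightarrow> 'b"
  assumes fin: "finite T" and AT: "A \<subseteq> span T" and A: "subspace A"
    and v: "\<And>i. v i \<in> span T" and v0: "v 0 \<notin> A"
  obtains m a where "v (Suc m) - (\<Sum>i\<le>m. a i *s v i) \<in> A"
    and "\<And>c. (\<Sum>i\<le>m. c i *s v i) \<in> A \<Longrightarrow> \<forall>i\<le>m. c i = 0"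
proof -
  define W where "W n = span (A \<union> v ` {..<n})" for n :: nat
  have WT: "W n \<subseteq> span T" for n
    unfolding W_def using AT v by (intro span_minimal) auto
  have "\<exists>n. v n \<in> W n"
  proof (rule ccontr)
    assume H: "\<nexists>n. v n \<in> W n"
    have "n \<le> dim (W n)" for n
    proof (induction n)
      case (Suc n)
      have sub: "W n \<subset> W (Suc n)"
      proof
        show "W n \<subseteq> W (Suc n)" unfolding W_def by (intro span_mono) auto
        have "v n \<in> W (Suc n)" unfolding W_def by (intro span_base) auto
        then show "W n \<noteq> W (Suc n)" using H by auto
      qed
      have "dim (W n) < dim (W (Suc n))"
        using dim_strict_mono_finite[OF fin WT sub] by (simp add: W_def)
      then show ?case using Suc by simp
    qed simp
    moreover have "dim (W n) \<le> dim (span T)" for n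
      using dim_mono_finite[OF fin order_refl WT] .
    ultimately show False by (meson not_less_eq_eq order_trans)
  qed
  then obtain n where n: "v n \<in> W n" and least: "\<And>i. i < n \<Longrightarrow> v i \<notin> W i"
    using exists_least_iff[of "\<lambda>n. v n \<in> W n"] by blast
  have "n \<noteq> 0"
  proof
    assume "n = 0"
    then show False using n v0 A by (simp add: W_def span_of_subspace)
  qed
  then obtain m where m: "n = Suc m" by (cases n) auto
  obtain a where a: "v n - (\<Sum>i<n. a i *s v i) \<in> A"
    using in_span_Un_image[OF A] n unfolding W_def by blast
  have indep: "\<forall>i\<le>m. c i = 0" if c: "(\<Sum>i\<le>m. c i *s v i) \<in> A" for c
  proof (rule ccontr)
    assume "\<not> (\<forall>i\<le>m. c i = 0)"
    then have ne: "{i. i \<le> m \<and> c i \<noteq> 0} \<noteq> {}" by auto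
    \<comment> \<open>Solving for the last vector with nonzero coefficient would place
      \<open>v j\<close> in \<open>W j\<close>, against the choice of \<open>n\<close>.\<close>
    define j where "j = Max {i. i \<le> m \<and> c i \<noteq> 0}"
    have j: "j \<le> m" "c j \<noteq> 0" using Max_in[OF _ ne] by (auto simp: j_def)
    have gt: "c i = 0" if "i \<le> m" "j < i" for i
      using that Max_ge[of "{i. i \<le> m \<and> c i \<noteq> 0}" i] by (fastforce simp: j_def)
    have "(\<Sum>i\<le>m. c i *s v i) = (\<Sum>i\<le>j. c i *s v i)"
      using j(1) gt by (intro sum.mono_neutral_right) auto
    also have "\<dots> = (\<Sum>i<j. c i *s v i) + c j *s v j"
      by (simp add: lessThan_Suc_atMost[symmetric])
    finally have "(\<Sum>i<j. c i *s v i) + c j *s v j \<in> W j"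
      using c unfolding W_def by (metis UnCI span_base)
    moreover have "(\<Sum>i<j. c i *s v i) \<in> W j"
      unfolding W_def by (intro span_sum span_scale span_base) auto
    ultimately have "c j *s v j \<in> W j"
      unfolding W_def by (simp add: span_add_eq)
    then have "inverse (c j) *s c j *s v j \<in> W j"
      unfolding W_def by (rule span_scale)
    then have "v j \<in> W j" using j(2) by simp
    then show False using least j(1) m by auto
  qed
  show thesis
    using that[of m a] a indep m by (simp add: lessThan_Suc_atMost)
qed

text \<open>
  The first linear relation \<open>\<phi>\<^sup>n b = \<Sum>\<^sub>i a\<^sub>i \<phi>\<^sup>i b\<close> modulo \<open>A\<close> turns the eigenvector equation for
  \<open>\<Sum>\<^sub>i c\<^sub>i \<phi>\<^sup>i b\<close> into the system \<open>coeffs\<close> over the field. It is applied with \<open>\<sigma>\<close> the identity (ordinary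
  eigenvectors) and with \<open>\<sigma>\<close> the Frobenius map (the \<open>p\<close>-map of an abelian quotient).
\<close>

lemma semilinear_eigenvector_mod:
  fixes \<phi> :: "'b \<Rightarrow> 'b" and \<sigma> :: "'a \<Rightarrow> 'a"
  assumes fin: "finite T" and BT: "B \<subseteq> span T" and AB: "A \<subset> B"
    and A: "subspace A" and B: "subspace B"
    and closed: "\<And>x. x \<in> B \<Longrightarrow> \<phi> x \<in> B"
    and add: "\<And>x y. x \<in> B \<Longrightarrow> y \<in> B \<Longrightarrow> \<phi> (x + y) - (\<phi> x + \<phi> y) \<in> A"
    and scale: "\<And>a x. x \<in> B \<Longrightarrow> \<phi> (a *s x) = \<sigma> a *s \<phi> x"
    and coeffs: "\<And>(m::nat) a. \<exists>\<mu> c. (\<exists>i\<le>m. c i \<noteq> 0) \<and>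
      (\<forall>i\<le>m. (case i of 0 \<Rightarrow> 0 | Suc j \<Rightarrow> \<sigma> (c j)) + \<sigma> (c m) * a i = \<mu> * c i)"
  obtains z \<mu> where "z \<in> B" "z \<notin> A" "\<phi> z - \<mu> *s z \<in> A"
proof -
  obtain b where b: "b \<in> B" "b \<notin> A" using AB by blast
  define v where "v i = (\<phi> ^^ i) b" for i
  have vB: "v i \<in> B" for i unfolding v_def by (induction i) (auto simp: b closed)
  have \<phi>v: "\<phi> (v i) = v (Suc i)" for i by (simp add: v_def)
  obtain m a where rel: "v (Suc m) - (\<Sum>i\<le>m. a i *s v i) \<in> A"
    and ind: "\<And>c. (\<Sum>i\<le>m. c i *s v i) \<in> A \<Longrightarrow> \<forall>i\<le>m. c i = 0"
  proof (rule first_relation[OF fin _ A])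
    show "A \<subseteq> span T" "\<And>i. v i \<in> span T" using AB BT vB by auto
    show "v 0 \<notin> A" by (simp add: v_def b)
  qed blast
  obtain \<mu> c where nz: "\<exists>i\<le>m. c i \<noteq> 0"
    and eq: "\<And>i. i \<le> m \<Longrightarrow> (case i of 0 \<Rightarrow> 0 | Suc j \<Rightarrow> \<sigma> (c j)) + \<sigma> (c m) * a i = \<mu> * c i"
    using coeffs[of m a] by blast
  have sumB: "(\<Sum>i\<le>k. c i *s v i) \<in> B" for k
    using B vB by (intro subspace_sum subspace_scale) auto
  \<comment> \<open>\<open>\<phi>\<close> is additive only modulo \<open>A\<close>, so its value on
    a sum is built up term by term.\<close>
  have \<phi>sum: "\<phi> (\<Sum>i\<le>k. c i *s v i) - (\<Sum>i\<le>k. \<sigma> (c i) *s v (Suc i)) \<in> A" for k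
  proof (induction k)
    case 0
    then show ?case using A by (simp add: scale vB \<phi>v subspace_0)
  next
    case (Suc k)
    let ?s = "\<Sum>i\<le>k. c i *s v i" and ?t = "\<Sum>i\<le>k. \<sigma> (c i) *s v (Suc i)"
    let ?w = "c (Suc k) *s v (Suc k)"
    have "\<phi> (?s + ?w) - (\<phi> ?s + \<phi> ?w) + (\<phi> ?s - ?t) \<in> A"
      using add[OF sumB, of ?w k] B vB Suc A by (intro subspace_add) (auto simp: subspace_scale)
    moreover have "\<phi> ?w = \<sigma> (c (Suc k)) *s v (Suc (Suc k))"
      by (simp add: scale vB \<phi>v)
    ultimately show ?case by (simp add: algebra_simps)
  qed
  define z where "z = (\<Sum>i\<le>m. c i *s v i)"
  have "z \<in> B" using sumB by (simp add: z_def)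
  moreover have "z \<notin> A" using ind[of c] nz unfolding z_def by auto
  moreover have "\<phi> z - \<mu> *s z \<in> A"
  proof -
    \<comment> \<open>Applying \<open>\<phi>\<close> shifts the coefficients up by one; the
      overflowing term in \<open>v (Suc m)\<close> is then reduced by \<open>rel\<close>.\<close>
    let ?d = "\<lambda>i. case i of 0 \<Rightarrow> 0 | Suc j \<Rightarrow> \<sigma> (c j)"
    have "(\<Sum>i\<le>m. \<sigma> (c i) *s v (Suc i)) = (\<Sum>i\<le>Suc m. ?d i *s v i)"
      by (simp add: sum.atMost_Suc_shift del: sum.atMost_Suc)
    then have shift: "(\<Sum>i\<le>m. \<sigma> (c i) *s v (Suc i))
        = (\<Sum>i\<le>m. ?d i *s v i) + \<sigma> (c m) *s v (Suc m)"
      by simp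
    have "\<mu> *s z = (\<Sum>i\<le>m. (?d i + \<sigma> (c m) * a i) *s v i)"
      unfolding z_def scale_sum_right by (rule sum.cong) (auto simp: eq)
    also have "\<dots> = (\<Sum>i\<le>m. ?d i *s v i) + \<sigma> (c m) *s (\<Sum>i\<le>m. a i *s v i)"
      by (simp add: scale_left_distrib sum.distrib scale_sum_right)
    finally have eigen: "\<phi> z - \<mu> *s z = (\<phi> z - (\<Sum>i\<le>m. \<sigma> (c i) *s v (Suc i)))
        + \<sigma> (c m) *s (v (Suc m) - (\<Sum>i\<le>m. a i *s v i))"
      by (simp add: shift scale_right_diff_distrib)
    show ?thesis
      unfolding eigen using \<phi>sum[of m] rel A
      by (intro subspace_add subspace_scale) (auto simp: z_def)
  qed
  ultimately show thesis by (rule that)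
qed

end

text \<open>\<open>P\<close> is the characteristic polynomial of the companion matrix with last
  column \<open>a\<close>. For a root \<open>\<mu>\<close>, comparing coefficients in
  \<open>P = (X - \<mu>) Q\<close> shows that those of \<open>Q\<close> form an eigenvector; the
  leading one is 1.\<close>

lemma linear_eigen_coeffs:
  fixes a :: "nat \<Rightarrow> 'k::alg_closed_field"
  shows "\<exists>\<mu> c. (\<exists>i\<le>m. c i \<noteq> 0) \<and>
    (\<forall>i\<le>m. (case i of 0 \<Rightarrow> 0 | Suc j \<Rightarrow> c j) + c m * a i = \<mu> * c i)"
proof -
  define P where "P = monom 1 (Suc m) - (\<Sum>i\<le>m. monom (a i) i)"
  have coeff_sum: "coeff (\<Sum>i\<le>m. monom (a i) i) j = (if j \<le> m then a j else 0)" for j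
    by (simp add: coeff_sum)
  have deg: "degree P = Suc m"
  proof (rule antisym)
    show "degree P \<le> Suc m"
      by (rule degree_le) (auto simp: P_def coeff_sum)
    show "Suc m \<le> degree P"
      by (rule le_degree) (simp add: P_def coeff_sum)
  qed
  obtain \<mu> where "poly P \<mu> = 0"
    using alg_closed_imp_poly_has_root[of P] deg by auto
  then obtain Q where Q: "P = [:-\<mu>, 1:] * Q"
    by (auto simp: poly_eq_0_iff_dvd)
  have "Q \<noteq> 0" using Q deg by auto
  then have dQ: "degree Q = m"
    using Q deg degree_mult_eq[of "[:-\<mu>, 1:]" Q] by simp
  have co: "coeff P i = (case i of 0 \<Rightarrow> 0 | Suc j \<Rightarrow> coeff Q j) - \<mu> * coeff Q i" for i
    by (simp add: Q coeff_pCons split: nat.split)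
  have cm: "coeff Q m = 1"
    using co[of "Suc m"] dQ by (simp add: P_def coeff_sum coeff_eq_0)
  have "(case i of 0 \<Rightarrow> 0 | Suc j \<Rightarrow> coeff Q j) + coeff Q m * a i = \<mu> * coeff Q i"
    if "i \<le> m" for i
    using co[of i] that cm by (simp add: P_def coeff_sum algebra_simps)
  then show ?thesis using cm by (intro exI[of _ \<mu>] exI[of _ "coeff Q"]) auto
qed

text \<open>
  If some \<open>a i\<close> is nonzero, the eigenvalue \<open>1\<close> is possible: solving from \<open>c 0\<close> upwards expresses every
  \<open>c i\<close> as a polynomial in \<open>t = c m\<close>, and the last equation has a nonzero root \<open>t\<close>.
\<close>

lemma frobenius_eigen_coeffs:
  fixes a :: "nat \<Rightarrow> 'k::alg_closed_field"
  assumes p: "p > 1"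
  shows "\<exists>\<mu> c. (\<exists>i\<le>m. c i \<noteq> 0) \<and>
    (\<forall>i\<le>m. (case i of 0 \<Rightarrow> 0 | Suc j \<Rightarrow> c j ^ p) + c m ^ p * a i = \<mu> * c i)"
proof (cases "\<forall>i\<le>m. a i = 0")
  case True
  \<comment> \<open>Here the last basis vector is sent to 0, so it is an eigenvector with eigenvalue
    0.\<close>
  then show ?thesis using p
    by (intro exI[of _ 0] exI[of _ "\<lambda>i. if i = m then 1 else 0"])
      (auto split: nat.split)
next
  case False
  define q where "q = rec_nat (monom (a 0) p) (\<lambda>i r. r ^ p + monom (a (Suc i)) p)"
  have q0: "q 0 = monom (a 0) p" and qS: "q (Suc i) = q i ^ p + monom (a (Suc i)) p" for i
    by (simp_all add: q_def)
  \<comment> \<open>Once some \<open>q i\<close> is nonzero it has degree at least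
    \<open>p > 1\<close>; its \<open>p\<close>-th power then has degree above \<open>p\<close> and
    cannot be cancelled by the monomial.\<close>
  have q: "(q i = 0 \<and> (\<forall>j\<le>i. a j = 0)) \<or> degree (q i) \<ge> p" for i
  proof (induction i)
    case 0
    then show ?case by (cases "a 0 = 0") (simp_all add: q0 degree_monom_eq)
  next
    case (Suc i)
    show ?case
    proof (cases "degree (q i) \<ge> p")
      case True
      have "p * 1 < p * degree (q i)" using True p by (intro mult_strict_left_mono) auto
      then have gt: "p < degree (q i ^ p)"
        using True p by (subst degree_power_eq) (auto simp: mult.commute)
      have "degree (q (Suc i)) = degree (q i ^ p)"
        unfolding qS
        by (rule degree_add_eq_left) (use gt degree_monom_le[of "a (Suc i)" p] in linarith)
      then show ?thesis using gt by simp
    next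
      case False
      then have z: "q i = 0" "\<forall>j\<le>i. a j = 0" using Suc by auto
      have "q (Suc i) = monom (a (Suc i)) p" using p by (simp add: qS z)
      then show ?thesis
        using z by (cases "a (Suc i) = 0") (auto simp: degree_monom_eq le_Suc_eq)
    qed
  qed
  \<comment> \<open>The factor \<open>X^2\<close> in \<open>q m\<close> turns the equation
    \<open>q m = X\<close>, after division by \<open>X\<close>, into \<open>X s - 1 = 0\<close>. All
    roots of the latter are nonzero, and there is one because \<open>s\<close> is nonzero.\<close>
  have mon: "monom 1 2 dvd monom b p" for b :: 'k
    using p by (intro dvdI[of _ _ "monom b (p - 2)"]) (simp add: mult_monom del: add_2_eq_Suc)
  have "monom 1 2 dvd q i" for i
  proof (induction i)
    case 0
    show ?case by (simp add: q0 mon)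
  next
    case (Suc i)
    have "monom 1 2 dvd q i ^ p" using p by (intro dvd_trans[OF Suc dvd_power]) auto
    then show ?case by (simp add: qS mon)
  qed
  then obtain s where s: "q m = monom 1 2 * s" by (meson dvdE)
  have degq: "degree (q m) \<ge> p" using q[of m] False by blast
  then have "s \<noteq> 0" using s p by auto
  then have "degree (pCons (-1) s) > 0" by (simp add: degree_pCons_eq)
  then obtain t where t: "poly (pCons (-1) s) t = 0"
    using alg_closed_imp_poly_has_root by blast
  then have ts: "t * poly s t = 1" by simp
  then have t0: "t \<noteq> 0" by auto
  have qt: "poly (q m) t = t"
    using ts by (simp add: s poly_monom power2_eq_square mult.assoc)
  have "(case i of 0 \<Rightarrow> 0 | Suc j \<Rightarrow> poly (q j) t ^ p) + poly (q m) t ^ p * a i = 1 * poly (q i) t" for i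
    unfolding qt by (cases i) (simp_all add: q0 qS poly_monom mult.commute)
  moreover have "\<exists>i\<le>m. poly (q i) t \<noteq> 0" using qt t0 by (metis order_refl)
  ultimately show ?thesis by (intro exI[of _ 1] exI[of _ "\<lambda>i. poly (q i) t"]) blast
qed

section \<open>Maximal restricted subalgebras\<close>

context lie_algebra
begin

section \<open>Bracket identities and stable subspaces\<close>

lemma zero_in_L: "0 \<in> L"
  using subspace_L by (rule subspace_0)

lemma bracket_zero_right [simp]: "x \<in> L \<Longrightarrow> bracket x 0 = 0"
  using bracket_scale_right[of x 0 0] zero_in_L by simp

lemma bracket_zero_left [simp]: "x \<in> L \<Longrightarrow> bracket 0 x = 0"
  using bracket_scale_left[of 0 x 0] zero_in_L by simp

lemma bracket_minus_right: "x \<in> L \<Longrightarrow> y \<in> L \<Longrightarrow> bracket x (- y) = - bracket x y"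
  using bracket_scale_right[of x y "-1"] by simp

lemma bracket_minus_left: "x \<in> L \<Longrightarrow> y \<in> L \<Longrightarrow> bracket (- x) y = - bracket x y"
  using bracket_scale_left[of x y "-1"] by simp

lemma bracket_diff_right:
  "x \<in> L \<Longrightarrow> y \<in> L \<Longrightarrow> z \<in> L \<Longrightarrow> bracket x (y - z) = bracket x y - bracket x z"
  using bracket_add_right[of x y "- z"] subspace_neg[OF subspace_L, of z]
  by (simp add: bracket_minus_right)

lemma bracket_diff_left:
  "x \<in> L \<Longrightarrow> y \<in> L \<Longrightarrow> z \<in> L \<Longrightarrow> bracket (x - y) z = bracket x z - bracket y z"
  using bracket_add_left[of x "- y" z] subspace_neg[OF subspace_L, of y]
  by (simp add: bracket_minus_left)

lemma bracket_anticomm: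
  assumes "x \<in> L" "y \<in> L"
  shows "bracket y x = - bracket x y"
proof -
  have "bracket (x + y) (x + y) = 0"
    using assms subspace_L by (intro bracket_self subspace_add)
  moreover have "bracket (x + y) (x + y) = bracket x y + bracket y x"
    using assms subspace_add[OF subspace_L assms] bracket_self[of x] bracket_self[of y]
    by (simp add: bracket_add_left bracket_add_right)
  ultimately have "bracket x y + bracket y x = 0" by simp
  then show ?thesis by (simp add: add_eq_0_iff)
qed

lemma bracket_leibniz:
  assumes "x \<in> L" "y \<in> L" "z \<in> L"
  shows "bracket x (bracket y z) = bracket (bracket x y) z + bracket y (bracket x z)"
proof -
  have "bracket z (bracket x y) = - bracket (bracket x y) z"
    using assms by (intro bracket_anticomm bracket_closed)
  moreover have "bracket y (bracket z x) = - bracket y (bracket x z)"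
    using assms by (simp add: bracket_anticomm[of x z] bracket_minus_right bracket_closed)
  ultimately show ?thesis
    using jacobi[OF assms] by (simp add: algebra_simps add_eq_0_iff)
qed

lemma ad_funpow_closed: "x \<in> L \<Longrightarrow> y \<in> L \<Longrightarrow> (bracket x ^^ n) y \<in> L"
  by (induction n) (auto simp: bracket_closed)

definition stable :: "'v set \<Rightarrow> 'v set \<Rightarrow> bool" where
  "stable F A \<longleftrightarrow> (\<forall>f\<in>F. \<forall>a\<in>A. bracket f a \<in> A)"

lemma stableD: "stable F A \<Longrightarrow> f \<in> F \<Longrightarrow> a \<in> A \<Longrightarrow> bracket f a \<in> A"
  by (simp add: stable_def)

lemma coeff_ad_pencil:
  assumes "x \<in> L" "y \<in> L"
  shows "coeff (ad_pencil x y w) i =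
    (case i of 0 \<Rightarrow> 0 | Suc j \<Rightarrow> bracket x (coeff w j)) + bracket y (coeff w i)"
  using assms by (simp add: ad_pencil_def coeff_pCons coeff_map_poly split: nat.split)

text \<open>The first application of the pencil to the constant \<open>[:x:]\<close> yields
  \<open>[x, x] X + [y, x]\<close>, whose first term vanishes and whose second lies in
  \<open>I\<close>; further applications stay in \<open>I\<close>. As \<open>p > 1\<close>, the
  exponent \<open>p - 1\<close> includes that first application.\<close>

lemma jacobson_poly_mem:
  assumes xy: "x \<in> L" "y \<in> L" and I: "subspace I" "stable {x, y} I"
    and yx: "bracket y x \<in> I" and char: "CHAR('k) > 1"
  shows "jacobson_poly i x y \<in> I"
proof -
  have I0: "0 \<in> I" using I(1) by (rule subspace_0)
  have "coeff ((ad_pencil x y ^^ Suc n) [:x:]) i \<in> I" for n i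
  proof (induction n arbitrary: i)
    case 0
    show ?case
      using xy yx I0 by (simp add: coeff_ad_pencil coeff_pCons bracket_self split: nat.split)
  next
    case (Suc n)
    have "coeff (ad_pencil x y ((ad_pencil x y ^^ Suc n) [:x:])) i \<in> I"
      unfolding coeff_ad_pencil[OF xy]
      using I I0 Suc by (intro subspace_add) (auto simp: stable_def split: nat.split)
    then show ?case by simp
  qed
  moreover have "CHAR('k) - 1 = Suc (CHAR('k) - 2)" using char by simp
  ultimately show ?thesis
    unfolding jacobson_poly_def using I(1) by (simp only: subspace_scale)
qed

end

section \<open>The p-map modulo stable subspaces, and closure of restricted subalgebras\<close>

context restricted_lie_algebra
begin

lemma char_gt_1: "CHAR('k) > 1"
  using char_pos CHAR_not_1[where ?'a = 'k] by (cases "CHAR('k)" rule: nat.exhaust) auto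

lemma pmap_add_mem:
  assumes "x \<in> L" "y \<in> L" "subspace I" "stable {x, y} I" "bracket y x \<in> I"
  shows "pmap (x + y) - (pmap x + pmap y) \<in> I"
proof -
  have "pmap (x + y) - (pmap x + pmap y) = (\<Sum>i=1..<CHAR('k). jacobson_poly i x y)"
    using assms by (simp add: pmap_add)
  then show ?thesis
    using assms char_gt_1 by (simp only:) (intro subspace_sum jacobson_poly_mem)
qed

text \<open>\<open>ad (pmap x)\<close> is the \<open>p\<close>-th power of \<open>ad x\<close> and
  \<open>p \<ge> 2\<close>: the two innermost factors land in \<open>A\<close> and the others stay
  there. A single bracket need not land in \<open>A\<close>, which is the situation in the
  supersolvable case.\<close>

lemma ad_pmap_mem2:
  assumes "x \<in> L" "a \<in> L" "bracket x (bracket x a) \<in> A" "stable {x} A"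
  shows "bracket (pmap x) a \<in> A"
proof -
  have "(bracket x ^^ n) (bracket x (bracket x a)) \<in> A" for n
    using assms by (induction n) (auto simp: stable_def)
  moreover have "CHAR('k) = Suc (Suc (CHAR('k) - 2))"
    using char_gt_1 by simp
  then have "(bracket x ^^ CHAR('k)) a = (bracket x ^^ (CHAR('k) - 2)) (bracket x (bracket x a))"
    by (metis comp_apply funpow_Suc_right)
  ultimately show ?thesis using assms by (simp add: ad_pmap)
qed

lemma ad_pmap_mem:
  "x \<in> L \<Longrightarrow> a \<in> L \<Longrightarrow> bracket x a \<in> A \<Longrightarrow> stable {x} A \<Longrightarrow> bracket (pmap x) a \<in> A"
  by (rule ad_pmap_mem2) (auto simp: stable_def)

lemma restricted_subalgebraD:
  assumes "restricted_subalgebra V"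
  shows "V \<subseteq> L" "subspace V" "\<And>x y. x \<in> V \<Longrightarrow> y \<in> V \<Longrightarrow> bracket x y \<in> V"
    "\<And>x. x \<in> V \<Longrightarrow> pmap x \<in> V" "0 \<in> V" "stable V V"
  using assms subspace_0 by (auto simp: restricted_subalgebra_def stable_def)

lemma restricted_subalgebra_L: "restricted_subalgebra L"
  using subspace_L bracket_closed pmap_closed by (auto simp: restricted_subalgebra_def)

lemma restricted_subalgebra_zero: "restricted_subalgebra {0}"
  using zero_in_L bracket_self pmap_scale[of 0 0] zero_power[OF char_pos, where ?'a = 'k]
  by (auto simp: restricted_subalgebra_def)

lemma restricted_subalgebra_Int:
  "restricted_subalgebra U \<Longrightarrow> restricted_subalgebra V \<Longrightarrow> restricted_subalgebra (U \<inter> V)"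
  by (auto simp: restricted_subalgebra_def subspace_inter)

lemma restricted_subalgebra_hull:
  assumes "S \<subseteq> L" shows "restricted_subalgebra (restricted_subalgebra hull S)"
proof -
  let ?F = "{T. restricted_subalgebra T \<and> S \<subseteq> T}"
  have "subspace (\<Inter>?F)"
    by (rule subspace_Inter) (auto simp: restricted_subalgebra_def)
  moreover have "\<Inter>?F \<subseteq> L"
    using assms restricted_subalgebra_L by blast
  moreover have "bracket x y \<in> \<Inter>?F" if "x \<in> \<Inter>?F" "y \<in> \<Inter>?F" for x y
    using that restricted_subalgebraD(3) by blast
  moreover have "pmap x \<in> \<Inter>?F" if "x \<in> \<Inter>?F" for x
    using that restricted_subalgebraD(4) by blast
  ultimately show ?thesis
    unfolding hull_def restricted_subalgebra_def[of "\<Inter>?F"] by blast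
qed

text \<open>
  With \<open>A = D\<close> this is the normaliser of \<open>D\<close> in \<open>V\<close>; with \<open>D\<close> an ideal of \<open>V\<close> it is the centraliser of
  \<open>A\<close> modulo \<open>D\<close>.
\<close>

lemma restricted_subalgebra_conductor:
  assumes V: "restricted_subalgebra V" and A: "A \<subseteq> L" and D: "D \<subseteq> L" "subspace D"
    and st: "stable {v \<in> V. \<forall>a\<in>A. bracket v a \<in> D} D"
  shows "restricted_subalgebra {v \<in> V. \<forall>a\<in>A. bracket v a \<in> D}" (is "restricted_subalgebra ?X")
proof -
  note Vs = restricted_subalgebraD[OF V]
  have XV: "?X \<subseteq> V" by blast
  have memL: "x \<in> L" if "x \<in> V" for x using that Vs(1) by blast
  have AL: "a \<in> L" if "a \<in> A" for a using that A by blast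
  have 1: "subspace ?X"
    using Vs(2) D memL AL
    by (intro subspaceI)
      (auto simp: bracket_add_left bracket_scale_left subspace_0 subspace_add subspace_scale)
  have 2: "bracket x y \<in> ?X" if x: "x \<in> ?X" and y: "y \<in> ?X" for x y
  proof -
    have "bracket (bracket x y) a \<in> D" if a: "a \<in> A" for a
    proof -
      have "bracket (bracket x y) a = bracket x (bracket y a) - bracket y (bracket x a)"
        using x y memL AL[OF a] bracket_leibniz[of x y a] by simp
      moreover have "bracket x (bracket y a) \<in> D" "bracket y (bracket x a) \<in> D"
        using stableD[OF st x] stableD[OF st y] x y a by blast+
      ultimately show ?thesis using D(2) by (simp add: subspace_diff)
    qed
    then show ?thesis using x y Vs(3) by blast
  qed
  have 3: "pmap x \<in> ?X" if x: "x \<in> ?X" for x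
  proof -
    have "stable {x} D" using st x by (auto simp: stable_def)
    then have "bracket (pmap x) a \<in> D" if "a \<in> A" for a
      using x that memL AL by (intro ad_pmap_mem) auto
    then show ?thesis using x Vs(4) by blast
  qed
  show ?thesis
    using XV Vs(1) unfolding restricted_subalgebra_def by (intro conjI ballI 1 2 3) auto
qed

text \<open>Brackets of elements \<open>m + k x\<close> expand into terms covered by
  \<open>M\<close> and \<open>xM\<close>. Once the span is closed under brackets, Jacobson's formula
  makes the p-map additive modulo the span, so its values on \<open>M\<close> and on
  \<open>x\<close> suffice.\<close>

lemma restricted_subalgebra_span_insert:
  assumes M: "restricted_subalgebra M" and x: "x \<in> L"
    and xM: "\<And>m. m \<in> M \<Longrightarrow> bracket x m \<in> span (insert x M)"
    and px: "pmap x \<in> span (insert x M)"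
  shows "restricted_subalgebra (span (insert x M))" (is "restricted_subalgebra ?S")
proof -
  note Ms = restricted_subalgebraD[OF M]
  have M_in_L: "m \<in> L" if "m \<in> M" for m using that Ms(1) by blast
  have SL: "?S \<subseteq> L"
    using x Ms(1) subspace_L by (simp add: span_insert_subset)
  have MS: "m \<in> ?S" if "m \<in> M" for m using that by (simp add: span_base)
  have xS: "x \<in> ?S" by (simp add: span_base)
  have decomp: "\<exists>m k. m \<in> M \<and> u = m + k *s x" if u: "u \<in> ?S" for u
  proof -
    obtain k where "u - k *s x \<in> M"
      using u Ms(2) mem_span_insert_subspace by blast
    then show ?thesis by (intro exI[of _ "u - k *s x"] exI[of _ k]) simp
  qed
  have kx: "k *s x \<in> L" for k using x subspace_L by (simp add: subspace_scale)
  have Mx: "bracket m x \<in> ?S" if "m \<in> M" for m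
    using xM[OF that] that x M_in_L by (simp add: bracket_anticomm[of x m] span_neg)
  have closed: "bracket u w \<in> ?S" if uw: "u \<in> ?S" "w \<in> ?S" for u w
  proof -
    obtain m k where u: "m \<in> M" "u = m + k *s x" using decomp uw(1) by blast
    obtain m' k' where w: "m' \<in> M" "w = m' + k' *s x" using decomp uw(2) by blast
    have "bracket u w = bracket m m' + k' *s bracket m x + k *s bracket x m'"
      using u w x M_in_L kx subspace_add[OF subspace_L]
      by (simp add: bracket_add_left bracket_add_right bracket_scale_left bracket_scale_right
          bracket_self)
    then show ?thesis
      using u(1) w(1) Mx xM Ms(3) MS by (simp add: span_add span_scale)
  qed
  have "pmap u \<in> ?S" if u0: "u \<in> ?S" for u
  proof -
    obtain m k where u: "m \<in> M" "u = m + k *s x" using decomp u0 by blast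
    have "pmap (m + k *s x) - (pmap m + pmap (k *s x)) \<in> ?S"
      using u(1) M_in_L kx closed MS xS
      by (intro pmap_add_mem) (auto simp: stable_def span_scale)
    moreover have "pmap m + pmap (k *s x) \<in> ?S"
      using u(1) Ms(4) MS px x by (intro span_add) (auto simp: pmap_scale span_scale)
    ultimately have "pmap (m + k *s x) - (pmap m + pmap (k *s x)) + (pmap m + pmap (k *s x)) \<in> ?S"
      by (rule span_add)
    then show ?thesis using u(2) by simp
  qed
  then show ?thesis
    using SL closed by (simp add: restricted_subalgebra_def)
qed

lemma maximal_inD:
  assumes "maximal_in U V"
  shows "restricted_subalgebra U" "restricted_subalgebra V" "U \<subset> V"
    "\<And>W. restricted_subalgebra W \<Longrightarrow> U \<subset> W \<Longrightarrow> W \<subseteq> V \<Longrightarrow> W = V"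
  using assms by (auto simp: maximal_in_def)

end

section \<open>Finite-dimensional algebras over an algebraically closed field\<close>

locale fd_restricted_lie_algebra = restricted_lie_algebra scale L bracket pmap
  for scale :: "'k::alg_closed_field \<Rightarrow> 'v::ab_group_add \<Rightarrow> 'v" (infixr \<open>*s\<close> 75)
    and L bracket pmap +
  assumes fd: "finite_dimensional"
begin

lemma finite_spanning_set: obtains T where "finite T" "span T = L"
  using fd unfolding finite_dimensional_def by blast

lemma dim_mono_L: "T \<subseteq> L \<Longrightarrow> S \<subseteq> T \<Longrightarrow> dim S \<le> dim T"
  using dim_mono_finite finite_spanning_set by metis

lemma dim_strict_mono_L:
  "T \<subseteq> L \<Longrightarrow> S \<subset> T \<Longrightarrow> subspace S \<Longrightarrow> subspace T \<Longrightarrow> dim S < dim T"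
  using dim_strict_mono_finite finite_spanning_set by metis

lemma dim_span_insert_L:
  "x \<in> L \<Longrightarrow> S \<subseteq> L \<Longrightarrow> subspace S \<Longrightarrow> x \<notin> S \<Longrightarrow> dim (span (insert x S)) = Suc (dim S)"
  using dim_span_insert finite_spanning_set by metis

lemma span_insert_codim_one:
  assumes "T \<subseteq> L" "subspace S" "subspace T" "S \<subset> T" "dim T = Suc (dim S)" "x \<in> T" "x \<notin> S"
  shows "T = span (insert x S)"
proof (rule ccontr)
  assume "T \<noteq> span (insert x S)"
  then have "span (insert x S) \<subset> T"
    using assms by (simp add: span_insert_subset psubset_eq)
  then have "dim (span (insert x S)) < dim T"
    using assms by (intro dim_strict_mono_L) auto
  moreover have "dim (span (insert x S)) = Suc (dim S)"
    using assms by (intro dim_span_insert_L) auto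
  ultimately show False using assms(5) by simp
qed

text \<open>A restricted subalgebra of \<open>V\<close> containing \<open>M\<close> and
  \<open>y\<close> is all of \<open>V\<close>. Applied to three conductors in turn, this shows that
  \<open>M\<close> is an ideal of \<open>V\<close>, that \<open>[V, y]\<close> lies in
  \<open>M\<close>, and that \<open>[V, V]\<close> lies in \<open>M\<close>. The p-map is then
  Frobenius-semilinear on \<open>V / M\<close>, and an eigenvector \<open>z\<close> makes
  \<open>M + k z\<close> restricted.\<close>

lemma maximal_normalized:
  assumes max: "maximal_in M V" and y: "y \<in> V" "y \<notin> M"
    and yM: "\<And>m. m \<in> M \<Longrightarrow> bracket y m \<in> M"
  shows "dim V = Suc (dim M)"
proof -
  note V = restricted_subalgebraD[OF maximal_inD(2)[OF max]]
  note M = restricted_subalgebraD[OF maximal_inD(1)[OF max]]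
  have MV: "M \<subset> V" using maximal_inD(3)[OF max] .
  have VL: "v \<in> L" if "v \<in> V" for v using V(1) that by blast
  have all: "X = V" if "restricted_subalgebra X" "M \<subseteq> X" "y \<in> X" "X \<subseteq> V" for X
    using maximal_inD(4)[OF max that(1)] that y by blast
  have "{v \<in> V. \<forall>a\<in>M. bracket v a \<in> M} = V"
    using y yM MV M
    by (intro all restricted_subalgebra_conductor maximal_inD(2)[OF max]) (auto simp: stable_def)
  then have MI: "bracket v m \<in> M" if "v \<in> V" "m \<in> M" for v m using that by blast
  have MI': "bracket m v \<in> M" if "v \<in> V" "m \<in> M" for v m
    using MI[OF that] that VL M(1) M(2)
    by (metis bracket_anticomm subspace_neg subset_iff)
  have "{v \<in> V. \<forall>a\<in>{y}. bracket v a \<in> M} = V"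
    using y MV M(1,2) VL MI MI' subspace_0[OF M(2)]
    by (intro all restricted_subalgebra_conductor maximal_inD(2)[OF max])
      (auto simp: stable_def bracket_self)
  then have "bracket v y \<in> M" if "v \<in> V" for v using that by blast
  then have yV: "bracket y v \<in> M" if "v \<in> V" for v
    using that VL y(1) M(2) by (metis bracket_anticomm subspace_neg)
  have "{v \<in> V. \<forall>a\<in>V. bracket v a \<in> M} = V"
    using y MV M(1,2) V(1) MI MI' yV
    by (intro all restricted_subalgebra_conductor maximal_inD(2)[OF max])
      (auto simp: stable_def)
  then have ab: "bracket v w \<in> M" if "v \<in> V" "w \<in> V" for v w using that by blast
  obtain T where T: "finite T" "span T = L" by (rule finite_spanning_set)
  obtain z \<mu> where z: "z \<in> V" "z \<notin> M" "pmap z - \<mu> *s z \<in> M"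
  proof (rule semilinear_eigenvector_mod[of T V M pmap "\<lambda>a. a ^ CHAR('k)"])
    show "finite T" "V \<subseteq> span T" "M \<subset> V" "subspace M" "subspace V"
      "\<And>x. x \<in> V \<Longrightarrow> pmap x \<in> V"
      using T V M MV by auto
    show "\<exists>\<mu> c. (\<exists>i\<le>m. c i \<noteq> 0) \<and> (\<forall>i\<le>m. (case i of 0 \<Rightarrow> 0 | Suc j \<Rightarrow> c j ^ CHAR('k)) +
      c m ^ CHAR('k) * a i = \<mu> * c i)" for m and a :: "nat \<Rightarrow> 'k"
      by (rule frobenius_eigen_coeffs[OF char_gt_1])
    show "pmap (x + w) - (pmap x + pmap w) \<in> M" if "x \<in> V" "w \<in> V" for x w
      using that VL M(2) MI ab by (intro pmap_add_mem) (auto simp: stable_def)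
    show "pmap (a *s x) = a ^ CHAR('k) *s pmap x" if "x \<in> V" for a x
      using that VL by (simp add: pmap_scale)
  qed
  have "restricted_subalgebra (span (insert z M))"
  proof (rule restricted_subalgebra_span_insert)
    show "pmap z \<in> span (insert z M)"
      using z(3) by (auto simp: mem_span_insert_subspace[OF M(2)])
  qed (use z VL MI maximal_inD(1)[OF max] in \<open>auto intro: span_base\<close>)
  moreover have "M \<subset> span (insert z M)"
    using z(2) span_superset[of "insert z M"] by blast
  moreover have "span (insert z M) \<subseteq> V"
    using z(1) MV V(2) by (simp add: span_insert_subset)
  ultimately have "span (insert z M) = V"
    using maximal_inD(4)[OF max] by blast
  then show ?thesis
    using dim_span_insert_L[of z M] z VL M by auto
qed

lemma exists_maximal_above:
  assumes "restricted_subalgebra W" "restricted_subalgebra V" "W \<subset> V"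
  obtains M where "maximal_in M V" "W \<subseteq> M"
proof -
  let ?P = "\<lambda>M. restricted_subalgebra M \<and> W \<subseteq> M \<and> M \<subset> V"
  have "?P W" using assms by blast
  moreover have "\<forall>M. ?P M \<longrightarrow> dim M < Suc (dim V)"
    using dim_mono_L restricted_subalgebraD(1)[OF assms(2)] by (auto simp: less_Suc_eq_le)
  ultimately obtain M where M: "?P M" and most: "\<And>N. ?P N \<Longrightarrow> dim N \<le> dim M"
    using ex_has_greatest_nat[of ?P W dim "Suc (dim V)"] by auto
  have "\<not> (\<exists>N. restricted_subalgebra N \<and> M \<subset> N \<and> N \<subset> V)"
  proof
    assume "\<exists>N. restricted_subalgebra N \<and> M \<subset> N \<and> N \<subset> V"
    then obtain N where N: "restricted_subalgebra N" "M \<subset> N" "N \<subset> V" by blast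
    then have "dim M < dim N"
      using M by (intro dim_strict_mono_L) (auto dest: restricted_subalgebraD(1,2))
    moreover have "dim N \<le> dim M" using M N by (intro most) blast
    ultimately show False by simp
  qed
  then have "maximal_in M V" using M assms(2) by (auto simp: maximal_in_def)
  then show thesis using that M by blast
qed

lemma dim_zero: "dim {0} = 0"
  using dim_eq_card[of "{}" "{0}"] independent_empty by simp

text \<open>The derived algebra \<open>D\<close> need not be restricted, so a conductor into the
  ideal \<open>E = [D, D]\<close> of \<open>V\<close> is taken instead. If \<open>?W\<close>, the
  elements taking \<open>D\<close> into \<open>E\<close>, is proper, it works. Otherwise
  \<open>D\<close> is central modulo \<open>E\<close> and lies in \<open>?Z\<close>, which is proper
  because \<open>?Z = V\<close> would give \<open>D \<subseteq> E\<close>.\<close>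

lemma exists_proper_above_derived:
  assumes "solvable" and V: "restricted_subalgebra V" and "V \<noteq> {0}"
  obtains W where "restricted_subalgebra W" "W \<subset> V" "\<And>v w. v \<in> V \<Longrightarrow> w \<in> V \<Longrightarrow> bracket v w \<in> W"
proof -
  define der where "der X = span {bracket x y | x y. x \<in> X \<and> y \<in> X}" for X
  note Vs = restricted_subalgebraD[OF V]
  define D where "D = der V"
  define E where "E = der D"
  have der_mono: "der X \<subseteq> der Y" if "X \<subseteq> Y" for X Y
    unfolding der_def using that by (intro span_mono) blast
  have der_base: "bracket x y \<in> der X" if "x \<in> X" "y \<in> X" for x y X
    unfolding der_def using that by (intro span_base) blast
  have DV: "D \<subseteq> V"
    unfolding D_def der_def using Vs(2,3) by (intro span_minimal) auto
  have ED: "E \<subseteq> D" unfolding E_def D_def using DV der_mono D_def by simp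
  have VL: "v \<in> L" if "v \<in> V" for v using Vs(1) that by blast
  have DL: "d \<in> L" if "d \<in> D" for d using DV VL that by blast
  have EL: "E \<subseteq> L" using ED DL by blast
  have subE: "subspace E" unfolding E_def der_def by simp
  have stE: "bracket v e \<in> E" if v: "v \<in> V" and e: "e \<in> E" for v e
  proof -
    let ?Y = "{e \<in> L. bracket v e \<in> E}"
    have "subspace ?Y"
      using subE subspace_L VL[OF v]
      by (intro subspaceI)
        (auto simp: subspace_0 subspace_add subspace_scale bracket_add_right bracket_scale_right)
    moreover have "bracket d d' \<in> ?Y" if d: "d \<in> D" "d' \<in> D" for d d'
    proof -
      have "bracket v d \<in> D" "bracket v d' \<in> D"
        using d DV v unfolding D_def by (auto intro: der_base)
      then have "bracket (bracket v d) d' \<in> E" "bracket d (bracket v d') \<in> E"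
        using d unfolding E_def by (auto intro: der_base)
      then show ?thesis
        using d DL VL[OF v] bracket_leibniz[of v d d'] subE
        by (simp add: bracket_closed subspace_add)
    qed
    ultimately have "E \<subseteq> ?Y"
      unfolding E_def[unfolded der_def] by (intro span_minimal) auto
    then show ?thesis using e by blast
  qed
  have restr: "restricted_subalgebra {v \<in> V. \<forall>a\<in>A. bracket v a \<in> E}" if "A \<subseteq> L" for A
    using V that EL subE stE by (intro restricted_subalgebra_conductor) (auto simp: stable_def)
  show thesis
  proof (cases "D \<subseteq> E")
    case True
    \<comment> \<open>Here \<open>D\<close> equals its own derived algebra, so it lies in every term
      of the derived series of \<open>L\<close> and vanishes.\<close>
    have "D \<subseteq> derived_series n" for n
    proof (induction n)
      case 0
      then show ?case using DL by auto
    next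
      case (Suc n)
      then have "E \<subseteq> derived_series (Suc n)"
        using der_mono[OF Suc] by (simp add: E_def der_def)
      then show ?case using True by blast
    qed
    then have "D \<subseteq> {0}" using assms(1) unfolding solvable_def by metis
    then have "bracket v w \<in> {0}" if "v \<in> V" "w \<in> V" for v w
      using der_base[OF that] unfolding D_def by blast
    then show thesis
      using that[OF restricted_subalgebra_zero] assms(3) Vs(5) by blast
  next
    case False
    let ?W = "{v \<in> V. \<forall>a\<in>D. bracket v a \<in> E}"
    let ?Z = "{v \<in> V. \<forall>a\<in>V. bracket v a \<in> E}"
    have Vder: "bracket v w \<in> D" if "v \<in> V" "w \<in> V" for v w
      using der_base[OF that] by (simp add: D_def)
    have DW: "D \<subseteq> ?W" using DV der_base unfolding E_def by blast
    have rW: "restricted_subalgebra ?W" using DL by (intro restr) blast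
    have rZ: "restricted_subalgebra ?Z" using VL by (intro restr) blast
    show thesis
    proof (cases "?W = V")
      case W: False
      then have "?W \<subset> V" by blast
      then show thesis using that[OF rW] DW Vder by blast
    next
      case W: True
      then have "bracket a d \<in> E" if "a \<in> V" "d \<in> D" for a d using that by blast
      then have "bracket d a \<in> E" if "a \<in> V" "d \<in> D" for a d
        using that VL DL bracket_anticomm[of a d] subE by (simp add: subspace_neg)
      then have DZ: "D \<subseteq> ?Z" using DV by blast
      have "?Z \<noteq> V"
      proof
        assume "?Z = V"
        then have "bracket v w \<in> E" if "v \<in> V" "w \<in> V" for v w using that by blast
        then have "D \<subseteq> E"
          unfolding D_def der_def using subE by (intro span_minimal) auto
        then show False using False by simp
      qed
      then have "?Z \<subset> V" by blast
      then show thesis using that[OF rZ] DZ Vder by blast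
    qed
  qed
qed

text \<open>A maximal \<open>M\<close> above the \<open>W\<close> just found contains
  \<open>[V, V]\<close>, so every element of \<open>V\<close> normalises it.\<close>

lemma exists_codim_one:
  assumes "solvable" "restricted_subalgebra V" "V \<noteq> {0}"
  shows "\<exists>M. maximal_in M V \<and> dim V = Suc (dim M) \<and> (\<forall>v\<in>V. \<forall>w\<in>V. bracket v w \<in> M)"
proof -
  obtain W where W: "restricted_subalgebra W" "W \<subset> V"
    "\<And>v w. v \<in> V \<Longrightarrow> w \<in> V \<Longrightarrow> bracket v w \<in> W"
    using exists_proper_above_derived[OF assms] by blast
  obtain M where M: "maximal_in M V" "W \<subseteq> M"
    using exists_maximal_above[OF W(1) assms(2) W(2)] by blast
  note MV = maximal_inD(3)[OF M(1)]
  obtain y where "y \<in> V" "y \<notin> M" using MV by blast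
  then have "dim V = Suc (dim M)"
    using W(3) M(2) MV by (intro maximal_normalized[OF M(1)]) blast+
  moreover have "bracket v w \<in> M" if "v \<in> V" "w \<in> V" for v w
    using W(3)[OF that] M(2) by blast
  ultimately show ?thesis using M(1) by blast
qed

section \<open>Codimension one compared with the J-condition, lower semimodularity and
  supersolvability\<close>

definition codim_one :: bool where
  "codim_one \<longleftrightarrow> (\<forall>U V. maximal_in U V \<longrightarrow> dim V = Suc (dim U))"

lemma J_series_snoc:
  assumes "J_series U M r C" "maximal_in M V"
  shows "J_series U V (Suc r) (C(Suc r := V))"
  using assms maximal_inD(2)[OF assms(2)] by (auto simp: J_series_def less_Suc_eq le_Suc_eq)

lemma exists_J_series_zero:
  assumes "solvable" "restricted_subalgebra V"
  shows "\<exists>C. J_series {0} V (dim V) C"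
  using assms(2)
proof (induction "dim V" arbitrary: V rule: less_induct)
  case less
  show ?case
  proof (cases "V = {0}")
    case True
    have "J_series {0} {0} 0 (\<lambda>_. {0})"
      using restricted_subalgebra_zero by (simp add: J_series_def)
    then show ?thesis unfolding True dim_zero by blast
  next
    case False
    obtain M where M: "maximal_in M V" "dim V = Suc (dim M)"
      using exists_codim_one[OF assms(1) less.prems False] by blast
    obtain C where "J_series {0} M (dim M) C"
      using less.hyps[OF _ maximal_inD(1)[OF M(1)]] M(2) by auto
    then have "J_series {0} V (dim V) (C(dim V := V))"
      unfolding M(2) using M(1) by (rule J_series_snoc)
    then show ?thesis by blast
  qed
qed

text \<open>Two series from 0 to \<open>V\<close> are compared: one of length \<open>dim V\<close>
  with steps of codimension one, and one passing through \<open>U\<close>, of length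
  \<open>dim U + 1\<close>.\<close>

lemma J_algebra_imp_codim_one:
  assumes "solvable" "J_algebra"
  shows "codim_one"
  unfolding codim_one_def
proof (intro allI impI)
  fix U V assume UV: "maximal_in U V"
  note U = maximal_inD(1)[OF UV] and V = maximal_inD(2)[OF UV]
  obtain C where "J_series {0} U (dim U) C" using exists_J_series_zero assms(1) U by blast
  then have 1: "J_series {0} V (Suc (dim U)) (C(Suc (dim U) := V))" using UV by (rule J_series_snoc)
  obtain C' where 2: "J_series {0} V (dim V) C'" using exists_J_series_zero assms(1) V by blast
  have "{0} \<subseteq> V" using restricted_subalgebraD(5)[OF V] by simp
  then obtain n where "\<And>r C. J_series {0} V r C \<Longrightarrow> r = n"
    using assms(2) restricted_subalgebra_zero V unfolding J_algebra_def by metis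
  then show "dim V = Suc (dim U)" using 1 2 by metis
qed

text \<open>Every step of a series raises the dimension by one, which forces the length.\<close>

lemma codim_one_imp_J_algebra:
  assumes "codim_one"
  shows "J_algebra"
  unfolding J_algebra_def
proof (intro allI impI)
  fix U V
  have "r = dim V - dim U" if C: "J_series U V r C" for r C
  proof -
    have "i \<le> r \<Longrightarrow> dim (C i) = dim U + i" for i
    proof (induction i)
      case 0
      then show ?case using C by (simp add: J_series_def)
    next
      case (Suc i)
      then have "maximal_in (C i) (C (Suc i))"
        using C by (simp add: J_series_def)
      then have "dim (C (Suc i)) = Suc (dim (C i))"
        using assms unfolding codim_one_def by blast
      then show ?case using Suc by simp
    qed
    from this[of r] show ?thesis using C by (simp add: J_series_def)
  qed
  then show "\<exists>n. \<forall>r C. J_series U V r C \<longrightarrow> r = n" by blast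
qed

text \<open>The generated algebra is \<open>U + k b\<close> with \<open>b\<close> in
  \<open>B\<close>. Intersecting with \<open>B\<close> gives
  \<open>B = (U \<inter> B) + k b\<close>, and codimension one leaves no room for an intermediate
  subalgebra.\<close>

lemma codim_one_imp_lower_semimodular:
  assumes "codim_one"
  shows "lower_semimodular"
  unfolding lower_semimodular_def lower_semimodular_in_def
proof (intro allI impI)
  fix U B
  let ?H = "restricted_subalgebra hull (U \<union> B)"
  assume U: "restricted_subalgebra U" and B: "restricted_subalgebra B" and max: "maximal_in U ?H"
  note Us = restricted_subalgebraD[OF U] and Bs = restricted_subalgebraD[OF B]
    and Hs = restricted_subalgebraD[OF maximal_inD(2)[OF max]]
  have "\<not> B \<subseteq> U"
  proof
    assume "B \<subseteq> U"
    then have "?H \<subseteq> U" using U by (intro hull_minimal) auto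
    then show False using maximal_inD(3)[OF max] by blast
  qed
  then obtain b where b: "b \<in> B" "b \<notin> U" by blast
  have BH: "B \<subseteq> ?H" using hull_subset[of "U \<union> B" restricted_subalgebra] by blast
  have "dim ?H = Suc (dim U)" using max assms by (simp add: codim_one_def)
  then have H: "?H = span (insert b U)"
    using Us(2) Hs(1,2) maximal_inD(3)[OF max] b BH by (intro span_insert_codim_one) auto
  note I = restricted_subalgebra_Int[OF U B]
  have sI: "subspace (U \<inter> B)" using restricted_subalgebraD(2)[OF I] .
  have "B = span (insert b (U \<inter> B))"
  proof
    show "span (insert b (U \<inter> B)) \<subseteq> B" using b Bs by (simp add: span_insert_subset)
    show "B \<subseteq> span (insert b (U \<inter> B))"
    proof
      fix x assume x: "x \<in> B"
      then have "x \<in> span (insert b U)" using BH H by blast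
      then obtain k where "x - k *s b \<in> U"
        unfolding mem_span_insert_subspace[OF Us(2)] by blast
      moreover have "x - k *s b \<in> B"
        using x b Bs(2) by (simp add: subspace_diff subspace_scale)
      ultimately show "x \<in> span (insert b (U \<inter> B))"
        by (auto simp: mem_span_insert_subspace[OF sI])
    qed
  qed
  moreover have "dim (span (insert b (U \<inter> B))) = Suc (dim (U \<inter> B))"
    using b Bs(1) Us(1) sI by (intro dim_span_insert_L) auto
  ultimately have dimB: "dim B = Suc (dim (U \<inter> B))" by simp
  have "\<not> (\<exists>W. restricted_subalgebra W \<and> U \<inter> B \<subset> W \<and> W \<subset> B)"
  proof
    assume "\<exists>W. restricted_subalgebra W \<and> U \<inter> B \<subset> W \<and> W \<subset> B"
    then obtain W where W: "restricted_subalgebra W" "U \<inter> B \<subset> W" "W \<subset> B" by blast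
    note Ws = restricted_subalgebraD[OF W(1)]
    have "dim (U \<inter> B) < dim W" using W Ws sI by (intro dim_strict_mono_L) auto
    moreover have "dim W < dim B" using W Ws Bs by (intro dim_strict_mono_L) auto
    ultimately show False using dimB by simp
  qed
  then show "maximal_in (U \<inter> B) B"
    using I B b by (auto simp: maximal_in_def)
qed

text \<open>\<open>U\<close> is compared with a maximal \<open>M\<close> of codimension one.
  Together they generate \<open>V\<close>, so lower semimodularity in both directions makes
  \<open>U \<inter> M\<close> maximal in \<open>U\<close> and in \<open>M\<close>. By induction it
  has codimension one in both, hence \<open>dim U = dim M\<close>.\<close>

lemma lower_semimodular_imp_codim_one:
  assumes "solvable" "lower_semimodular"
  shows "codim_one"
proof -
  have "dim V = Suc (dim U)" if "maximal_in U V" for U V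
    using that
  proof (induction "dim V" arbitrary: U V rule: less_induct)
    case less
    note max = less.prems
    note U = maximal_inD(1)[OF max] and V = maximal_inD(2)[OF max] and UV = maximal_inD(3)[OF max]
    have "V \<noteq> {0}" using restricted_subalgebraD(5)[OF U] UV by blast
    then obtain M where M: "maximal_in M V" "dim V = Suc (dim M)"
      using exists_codim_one[OF assms(1) V] by blast
    note MV = maximal_inD(3)[OF M(1)] and Mr = maximal_inD(1)[OF M(1)]
    show ?case
    proof (cases "U = M")
      case True
      then show ?thesis using M by simp
    next
      case False
      have VL: "V \<subseteq> L" using restricted_subalgebraD(1)[OF V] .
      let ?H = "restricted_subalgebra hull (U \<union> M)"
      have "U \<union> M \<subseteq> L" using UV MV VL by blast
      then have rH: "restricted_subalgebra ?H" by (rule restricted_subalgebra_hull)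
      have sub: "U \<union> M \<subseteq> ?H" by (rule hull_subset)
      have HV: "?H \<subseteq> V" using UV MV V by (intro hull_minimal) auto
      \<comment> \<open>Otherwise \<open>M\<close> would lie properly inside \<open>U\<close>,
        against its maximality.\<close>
      have "U \<noteq> ?H"
      proof
        assume "U = ?H"
        then have "M \<subset> U" using sub False by blast
        then show False using maximal_inD(4)[OF M(1) U] UV by blast
      qed
      then have H: "?H = V" using maximal_inD(4)[OF max rH _ HV] sub by blast
      then have H': "restricted_subalgebra hull (M \<union> U) = V" by (simp add: Un_commute)
      have 1: "maximal_in (U \<inter> M) M"
        using assms(2) U Mr H max unfolding lower_semimodular_def lower_semimodular_in_def by simp
      have "maximal_in (M \<inter> U) U"
        using assms(2) U Mr H' M(1) unfolding lower_semimodular_def lower_semimodular_in_def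
        by simp
      then have 2: "maximal_in (U \<inter> M) U" by (simp add: Int_commute)
      have "dim U < dim V"
        using U V UV VL restricted_subalgebraD(2) by (intro dim_strict_mono_L) auto
      then have "dim U = Suc (dim (U \<inter> M))" "dim M = Suc (dim (U \<inter> M))"
        using less.hyps[OF _ 1] less.hyps[OF _ 2] M(2) by auto
      then show ?thesis using M(2) by simp
    qed
  qed
  then show ?thesis by (simp add: codim_one_def)
qed

text \<open>Choosing the first ideal that meets \<open>V\<close> outside \<open>U\<close> gives
  \<open>C i \<inter> V \<subseteq> U\<close>, so brackets of \<open>x\<close> with \<open>V\<close>
  lie in \<open>k x\<close> plus a subspace of \<open>U\<close>. Only \<open>pmap x\<close> can then
  prevent \<open>U + k x\<close> from being restricted.\<close>

lemma supersolvable_imp_codim_one: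
  assumes "supersolvable"
  shows "codim_one"
  unfolding codim_one_def
proof (intro allI impI)
  fix U V assume max: "maximal_in U V"
  note Us = restricted_subalgebraD[OF maximal_inD(1)[OF max]]
    and Vs = restricted_subalgebraD[OF maximal_inD(2)[OF max]] and UV = maximal_inD(3)[OF max]
  have VL: "v \<in> L" if "v \<in> V" for v using Vs(1) that by blast
  obtain n C where C0: "C 0 = {0}" and Cn: "C n = L"
    and Ci: "\<And>j. j \<le> n \<Longrightarrow> ideal (C j) \<and> dim (C j) = j"
    and CS: "\<And>j. j < n \<Longrightarrow> C j \<subset> C (Suc j)"
    using assms unfolding supersolvable_def by blast
  let ?P = "\<lambda>j. \<not> C j \<inter> V \<subseteq> U"
  have "?P n" using Cn UV Vs(1) by blast
  define j where "j = (LEAST j. ?P j)"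
  have Pj: "?P j" unfolding j_def by (rule LeastI) fact
  have jn: "j \<le> n" unfolding j_def by (rule Least_le) fact
  have "j \<noteq> 0" using Pj C0 Us(5) by (metis Int_lower1 empty_subsetI insert_subset order_trans)
  then obtain i where i: "j = Suc i" by (cases j) auto
  have lo: "C i \<inter> V \<subseteq> U"
    using not_less_Least[of i ?P] i unfolding j_def by auto
  obtain x where x: "x \<in> C (Suc i)" "x \<in> V" "x \<notin> U" using Pj i by blast
  have idl: "ideal (C i)" "ideal (C (Suc i))" "dim (C (Suc i)) = Suc (dim (C i))"
    using Ci[of i] Ci[of "Suc i"] jn i by auto
  have xL: "x \<in> L" using x VL by blast
  have xC: "x \<notin> C i" using lo x by blast
  have CSi: "C (Suc i) = span (insert x (C i))"
    using idl x xC CS[of i] jn i by (intro span_insert_codim_one) (auto simp: ideal_def)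
  have sCi: "subspace (C i)" using idl by (simp add: ideal_def)
  have br: "\<exists>k. bracket x u - k *s x \<in> C i \<inter> V" if u: "u \<in> V" for u
  proof -
    have "bracket u x \<in> C (Suc i)" using idl x u VL by (auto simp: ideal_def)
    then have "bracket x u \<in> C (Suc i)"
      using idl(2) bracket_anticomm[of u x] xL VL[OF u] by (simp add: ideal_def subspace_neg)
    then obtain k where "bracket x u - k *s x \<in> C i"
      using CSi by (auto simp: mem_span_insert_subspace[OF sCi])
    moreover have "bracket x u - k *s x \<in> V"
      using x u Vs(2,3) by (simp add: subspace_diff subspace_scale)
    ultimately show ?thesis by blast
  qed
  show "dim V = Suc (dim U)"
  proof (cases "pmap x \<in> span (insert x U)")
    case True
    have "restricted_subalgebra (span (insert x U))"
    proof (rule restricted_subalgebra_span_insert[OF maximal_inD(1)[OF max] xL _ True])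
      fix u assume "u \<in> U"
      then obtain k where "bracket x u - k *s x \<in> C i \<inter> V" using br UV by blast
      then show "bracket x u \<in> span (insert x U)"
        using lo by (auto simp: mem_span_insert_subspace[OF Us(2)])
    qed
    moreover have "U \<subset> span (insert x U)" using x(3) span_superset[of "insert x U"] by blast
    moreover have "span (insert x U) \<subseteq> V" using x UV Vs(2) by (simp add: span_insert_subset)
    ultimately have "span (insert x U) = V" using maximal_inD(4)[OF max] by blast
    then show ?thesis using dim_span_insert_L[OF xL Us(1,2) x(3)] by simp
  next
    case False
    then have "pmap x \<notin> U" using span_superset[of "insert x U"] by blast
    moreover have "bracket (pmap x) u \<in> U" if "u \<in> U" for u
    proof -
      have uV: "u \<in> V" using that UV by blast
      obtain k where k: "bracket x u - k *s x \<in> C i \<inter> V" using br[OF uV] by blast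
      have st: "bracket x c \<in> C i \<inter> V" if "c \<in> C i \<inter> V" for c
        using that x xL idl Vs(3) by (auto simp: ideal_def)
      \<comment> \<open>The multiple of \<open>x\<close> in \<open>bracket x u\<close> dies under a
        second bracket with \<open>x\<close>. Hence \<open>[x, [x, u]]\<close>, and with it
        \<open>[pmap x, u]\<close>, lies in \<open>C i \<inter> V\<close>, and \<open>pmap x\<close>
        normalises \<open>U\<close>.\<close>
      have "bracket x (bracket x u - k *s x) = bracket x (bracket x u)"
        using xL VL[OF uV]
        by (simp add: bracket_diff_right bracket_closed subspace_scale[OF subspace_L]
            bracket_scale_right bracket_self)
      then have "bracket x (bracket x u) \<in> C i \<inter> V" using st[OF k] by simp
      then have "bracket (pmap x) u \<in> C i \<inter> V"
        using xL VL[OF uV] st by (intro ad_pmap_mem2) (auto simp: stable_def)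
      then show ?thesis using lo by blast
    qed
    ultimately show ?thesis
      using x Vs(4) by (intro maximal_normalized[OF max, of "pmap x"]) auto
  qed
qed

end

section \<open>Flags of ideals\<close>

context lie_algebra
begin

text \<open>\<open>F\<close> acts triangularly from \<open>A\<close> up to \<open>B\<close>. Keeping
  \<open>F\<close> separate from the spaces lets one notion serve both for a subalgebra acting on a
  larger algebra and for chains of ideals.\<close>

inductive flag :: "'v set \<Rightarrow> 'v set \<Rightarrow> 'v set \<Rightarrow> bool" for F A where
  flag_refl: "flag F A A"
| flag_step: "flag F A B \<Longrightarrow> x \<in> L \<Longrightarrow> x \<notin> B \<Longrightarrow> stable F (span (insert x B)) \<Longrightarrow>
    flag F A (span (insert x B))"

lemma flag_subspace: "flag F A B \<Longrightarrow> subspace A \<Longrightarrow> subspace B"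
  by (induction rule: flag.induct) auto

lemma flag_stable: "flag F A B \<Longrightarrow> stable F A \<Longrightarrow> stable F B"
  by (induction rule: flag.induct) auto

lemma flag_subset_L: "flag F A B \<Longrightarrow> A \<subseteq> L \<Longrightarrow> B \<subseteq> L"
  by (induction rule: flag.induct) (auto dest: span_insert_subset[OF subspace_L])

lemma flag_trans: "flag F B D \<Longrightarrow> flag F A B \<Longrightarrow> flag F A D"
  by (induction rule: flag.induct) (auto intro: flag_step)

text \<open>Modulo \<open>B\<close> both operators act on \<open>x\<close> by scalars, and scalars
  commute; the remainders stay in \<open>B\<close> by stability.\<close>

lemma bracket_common_eigenvector_mod:
  assumes L: "f \<in> L" "g \<in> L" "x \<in> L" and B: "B \<subseteq> L" "subspace B" "stable {f, g} B"
    and fx: "bracket f x - \<alpha> *s x \<in> B" and gx: "bracket g x - \<beta> *s x \<in> B"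
  shows "bracket (bracket f g) x \<in> B"
proof -
  let ?f = "bracket f x - \<alpha> *s x" and ?g = "bracket g x - \<beta> *s x"
  have sc: "k *s y \<in> L" if "y \<in> L" for k y using that subspace_L by (simp add: subspace_scale)
  have "bracket (bracket f g) x = bracket f (bracket g x) - bracket g (bracket f x)"
    using bracket_leibniz[of f g x] L by simp
  also have "\<dots> = bracket f ?g - bracket g ?f + (\<beta> *s ?f - \<alpha> *s ?g)"
    using L
    by (simp add: bracket_diff_right bracket_closed sc bracket_scale_right scale_right_diff_distrib
        scale_left_commute)
  also have "\<dots> \<in> B"
  proof -
    have "bracket f ?g \<in> B" "bracket g ?f \<in> B" using B(3) fx gx by (auto intro: stableD)
    then show ?thesis
      using B(2) fx gx by (intro subspace_add[OF B(2) subspace_diff subspace_diff] subspace_scale)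
  qed
  finally show ?thesis .
qed

text \<open>On each one-dimensional layer \<open>f\<close> and \<open>g\<close> act by scalars, so
  their commutator moves everything one layer down; \<open>n\<close> counts the layers.\<close>

lemma flag_commutator_nilpotent:
  assumes "flag F A B" "A \<subseteq> L" "subspace A" "stable F A" "F \<subseteq> L" "f \<in> F" "g \<in> F"
  shows "\<exists>n. \<forall>b\<in>B. (bracket (bracket f g) ^^ n) b \<in> A"
  using assms(1)
proof (induction rule: flag.induct)
  case flag_refl
  show ?case by (rule exI[of _ 0]) simp
next
  case (flag_step B x)
  let ?B' = "span (insert x B)" and ?c = "bracket f g"
  have B: "subspace B" "stable F B" "B \<subseteq> L"
    using flag_step.hyps(1) assms flag_subspace flag_stable flag_subset_L by blast+
  have fg: "f \<in> L" "g \<in> L" using assms by auto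
  have x': "x \<in> ?B'" by (simp add: span_base)
  have "bracket f x \<in> ?B'" "bracket g x \<in> ?B'"
    using flag_step.hyps(4) x' assms by (auto intro: stableD)
  then obtain \<alpha> \<beta> where "bracket f x - \<alpha> *s x \<in> B" "bracket g x - \<beta> *s x \<in> B"
    unfolding mem_span_insert_subspace[OF B(1)] by blast
  then have cx: "bracket ?c x \<in> B"
    using fg flag_step.hyps(2) B assms(6,7)
    by (intro bracket_common_eigenvector_mod[of f g x B \<alpha> \<beta>]) (auto simp: stable_def)
  have cB: "bracket ?c b \<in> B" if b: "b \<in> B" for b
  proof -
    have "bracket ?c b = bracket f (bracket g b) - bracket g (bracket f b)"
      using bracket_leibniz[of f g b] fg b B(3) by auto
    then show ?thesis
      using B assms(6,7) b by (auto intro!: subspace_diff simp: stable_def)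
  qed
  have down: "bracket ?c b \<in> B" if b: "b \<in> ?B'" for b
  proof -
    obtain k where k: "b - k *s x \<in> B" using b unfolding mem_span_insert_subspace[OF B(1)] by blast
    have kx: "k *s x \<in> L" using flag_step.hyps(2) subspace_L by (simp add: subspace_scale)
    have "bracket ?c (b - k *s x + k *s x) = bracket ?c (b - k *s x) + k *s bracket ?c x"
      using fg k kx B(3) flag_step.hyps(2)
      by (subst bracket_add_right) (auto simp: bracket_closed bracket_scale_right)
    also have "\<dots> \<in> B" using cB[OF k] cx B(1) by (simp add: subspace_add subspace_scale)
    finally show ?thesis by simp
  qed
  obtain n where "\<forall>b\<in>B. (bracket ?c ^^ n) b \<in> A" using flag_step.IH by blast
  then show ?case using down by (intro exI[of _ "Suc n"]) (simp add: funpow_Suc_right del: funpow.simps)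
qed

text \<open>Consider the first layer of the flag where \<open>B\<close> leaves \<open>A\<close>. An
  element \<open>b\<close> found there involves \<open>x\<close>, so subtracting a multiple of
  \<open>b\<close> from \<open>bracket f b\<close> removes \<open>x\<close> and leaves an element of
  \<open>B \<inter> D\<close>, hence of \<open>A\<close>.\<close>

lemma flag_common_eigenvector_mod:
  assumes "flag F A\<^sub>0 D" "subspace A\<^sub>0" "A\<^sub>0 \<subseteq> A" "subspace A" "subspace B" "stable F B"
    and "\<not> B \<inter> D \<subseteq> A"
  shows "\<exists>b\<in>B - A. \<forall>f\<in>F. \<exists>\<mu>. bracket f b - \<mu> *s b \<in> A"
  using assms(1,7)
proof (induction rule: flag.induct)
  case flag_refl
  then show ?case using assms(3) by blast
next
  case (flag_step D x)
  have D: "subspace D" using flag_step.hyps(1) assms(2) by (rule flag_subspace)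
  show ?case
  proof (cases "B \<inter> D \<subseteq> A")
    case False
    then show ?thesis using flag_step.IH by blast
  next
    case True
    obtain b where b: "b \<in> B" "b \<in> span (insert x D)" "b \<notin> A" using flag_step.prems by blast
    obtain k where k: "b - k *s x \<in> D"
      using b(2) unfolding mem_span_insert_subspace[OF D] by blast
    have k0: "k \<noteq> 0" using k b True by auto
    have "\<exists>\<mu>. bracket f b - \<mu> *s b \<in> A" if f: "f \<in> F" for f
    proof -
      have "bracket f b \<in> span (insert x D)" using flag_step.hyps(4) f b(2) by (rule stableD)
      then obtain j where j: "bracket f b - j *s x \<in> D"
        unfolding mem_span_insert_subspace[OF D] by blast
      have "bracket f b - (j / k) *s b = (bracket f b - j *s x) - (j / k) *s (b - k *s x)"
        using k0 by (simp add: scale_right_diff_distrib)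
      moreover have "\<dots> \<in> D" by (rule subspace_diff[OF D j subspace_scale[OF D k]])
      moreover have "bracket f b - (j / k) *s b \<in> B"
        using subspace_diff[OF assms(5) stableD[OF assms(6) f b(1)] subspace_scale[OF assms(5) b(1)]] .
      ultimately show ?thesis using True by (metis IntI subsetD)
    qed
    then show ?thesis using b by blast
  qed
qed

section \<open>Powers of an adjoint map and the Fitting decomposition\<close>

lemma ad_funpow_add:
  "c \<in> L \<Longrightarrow> u \<in> L \<Longrightarrow> v \<in> L \<Longrightarrow> (bracket c ^^ n) (u + v) = (bracket c ^^ n) u + (bracket c ^^ n) v"
  by (induction n) (auto simp: bracket_add_right ad_funpow_closed)

lemma ad_funpow_diff:
  "c \<in> L \<Longrightarrow> u \<in> L \<Longrightarrow> v \<in> L \<Longrightarrow> (bracket c ^^ n) (u - v) = (bracket c ^^ n) u - (bracket c ^^ n) v"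
  by (induction n) (auto simp: bracket_diff_right ad_funpow_closed)

lemma ad_funpow_scale:
  "c \<in> L \<Longrightarrow> u \<in> L \<Longrightarrow> (bracket c ^^ n) (k *s u) = k *s (bracket c ^^ n) u"
  by (induction n) (auto simp: bracket_scale_right ad_funpow_closed)

lemma ad_funpow_zero: "c \<in> L \<Longrightarrow> (bracket c ^^ n) 0 = 0"
  by (induction n) auto

lemma ad_funpow_zero_mono:
  assumes "c \<in> L" "(bracket c ^^ m) u = 0" "m \<le> n"
  shows "(bracket c ^^ n) u = 0"
proof -
  have "(bracket c ^^ n) u = (bracket c ^^ (n - m)) ((bracket c ^^ m) u)"
    using assms(3) by (simp flip: funpow_add[THEN fun_cong, simplified comp_apply])
  then show ?thesis using assms by (simp add: ad_funpow_zero)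
qed

text \<open>By the Leibniz rule, \<open>bracket c\<close> hits one of the two factors, which lowers
  \<open>i + j\<close>.\<close>

lemma ad_funpow_bracket_zero:
  assumes "c \<in> L"
  shows "u \<in> L \<Longrightarrow> v \<in> L \<Longrightarrow> (bracket c ^^ i) u = 0 \<Longrightarrow> (bracket c ^^ j) v = 0 \<Longrightarrow>
    (bracket c ^^ (i + j)) (bracket u v) = 0"
proof (induction "i + j" arbitrary: i j u v)
  case 0
  then show ?case by simp
next
  case (Suc n)
  show ?case
  proof (cases "i = 0 \<or> j = 0")
    case True
    then have "bracket u v = 0" using Suc.prems by auto
    then show ?thesis using assms by (simp add: ad_funpow_zero)
  next
    case False
    then obtain i' j' where ij: "i = Suc i'" "j = Suc j'" by (meson not0_implies_Suc)
    have n: "n = i' + j" "n = i + j'" using Suc.hyps(2) ij by auto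
    have cuv: "bracket c u \<in> L" "bracket c v \<in> L"
      using assms Suc.prems by (auto simp: bracket_closed)
    have "(bracket c ^^ i') (bracket c u) = 0" "(bracket c ^^ j') (bracket c v) = 0"
      using Suc.prems ij by (auto simp: funpow_Suc_right simp del: funpow.simps)
    then have "(bracket c ^^ n) (bracket (bracket c u) v) = 0"
      "(bracket c ^^ n) (bracket u (bracket c v)) = 0"
      using Suc.hyps(1)[OF n(1)] Suc.hyps(1)[OF n(2)] Suc.prems cuv n by auto
    then have "(bracket c ^^ n) (bracket c (bracket u v)) = 0"
      using assms Suc.prems cuv bracket_leibniz[of c u v]
      by (simp add: ad_funpow_add bracket_closed)
    then show ?thesis
      using Suc.hyps(2) by (metis comp_apply funpow_Suc_right)
  qed
qed

end

text \<open>For the p-map: \<open>c\<close> lies in \<open>K\<close>, and \<open>K\<close> is closed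
  under brackets, so \<open>p\<close> applications of \<open>ad x\<close> to \<open>c\<close> stay
  in \<open>K\<close>. Hence \<open>[c, pmap x]\<close> is in \<open>K\<close>, and one more power
  of \<open>ad c\<close> kills \<open>pmap x\<close>.\<close>

lemma (in restricted_lie_algebra) restricted_subalgebra_fitting_null:
  assumes V: "restricted_subalgebra V" and c: "c \<in> V"
  shows "restricted_subalgebra {u \<in> V. \<exists>n. (bracket c ^^ n) u = 0}" (is "restricted_subalgebra ?K")
proof -
  note Vs = restricted_subalgebraD[OF V]
  have VL: "v \<in> L" if "v \<in> V" for v using that Vs(1) by blast
  have cL: "c \<in> L" using c VL by blast
  have sub: "subspace ?K"
  proof (rule subspaceI)
    show "0 \<in> ?K" using Vs(5) by (auto intro: exI[of _ 0])
  next
    fix x y assume x: "x \<in> ?K" and y: "y \<in> ?K"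
    then obtain n m where "(bracket c ^^ n) x = 0" "(bracket c ^^ m) y = 0" by blast
    then have "(bracket c ^^ (n + m)) x = 0" "(bracket c ^^ (n + m)) y = 0"
      using ad_funpow_zero_mono[OF cL] by auto
    then have "(bracket c ^^ (n + m)) (x + y) = 0"
      using x y VL cL by (simp add: ad_funpow_add)
    then show "x + y \<in> ?K" using x y Vs(2) by (auto intro: subspace_add)
  next
    fix k x assume "x \<in> ?K"
    then show "k *s x \<in> ?K"
      using VL cL Vs(2) by (auto simp: ad_funpow_scale subspace_scale)
  qed
  have br: "bracket x y \<in> ?K" if "x \<in> ?K" "y \<in> ?K" for x y
    using that ad_funpow_bracket_zero[OF cL] VL Vs(3) by blast
  have cK: "c \<in> ?K" using c cL by (auto intro!: exI[of _ 1] simp: bracket_self)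
  have "pmap x \<in> ?K" if x: "x \<in> ?K" for x
  proof -
    have pV: "pmap x \<in> V" using x Vs(4) by blast
    have pc: "bracket (pmap x) c \<in> ?K"
      using x VL cL br[OF x cK] br[OF x] by (intro ad_pmap_mem) (auto simp: stable_def)
    then have "bracket c (pmap x) \<in> ?K"
      using bracket_anticomm[of "pmap x" c] cL VL[OF pV] subspace_neg[OF sub pc] by simp
    then obtain n where "(bracket c ^^ n) (bracket c (pmap x)) = 0" by blast
    then have "(bracket c ^^ Suc n) (pmap x) = 0" by (simp add: funpow_Suc_right del: funpow.simps)
    then show ?thesis using pV by blast
  qed
  then show ?thesis
    using sub br Vs(1) unfolding restricted_subalgebra_def by (intro conjI ballI) auto
qed

context fd_restricted_lie_algebra
begin

text \<open>The images of the powers of \<open>ad c\<close> on \<open>V\<close> stabilise, so the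
  \<open>N\<close>-th power at \<open>v\<close> is also a value of the \<open>2 N\<close>-th power.
  The correction is written as a double bracket because, in the application, \<open>c\<close> and
  \<open>[c, w]\<close> lie in \<open>M\<close>, which places it in \<open>[M, M]\<close>.\<close>

lemma fitting_decomposition:
  assumes c: "c \<in> L" and V: "V \<subseteq> L" "subspace V" "\<And>v. v \<in> V \<Longrightarrow> bracket c v \<in> V" and v: "v \<in> V"
  obtains w n where "w \<in> V" "(bracket c ^^ n) (v - bracket c (bracket c w)) = 0"
proof -
  let ?f = "bracket c"
  define I where "I n = (?f ^^ n) ` V" for n
  have fV: "(?f ^^ n) u \<in> V" if "u \<in> V" for u n
    using that V(3) by (induction n) auto
  have subI: "subspace (I n)" for n
  proof (rule subspaceI)
    show "0 \<in> I n"
      unfolding I_def using c V(2) by (intro image_eqI[of _ _ 0]) (auto simp: ad_funpow_zero subspace_0)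
  next
    fix x y assume "x \<in> I n" "y \<in> I n"
    then obtain x' y' where xy: "x' \<in> V" "y' \<in> V" "x = (?f ^^ n) x'" "y = (?f ^^ n) y'"
      unfolding I_def by blast
    then have "x + y = (?f ^^ n) (x' + y')"
      using c V(1) by (subst ad_funpow_add) auto
    then show "x + y \<in> I n" unfolding I_def using xy V(2) by (auto simp: subspace_add)
  next
    fix k x assume "x \<in> I n"
    then obtain x' where x: "x' \<in> V" "x = (?f ^^ n) x'" unfolding I_def by blast
    then have "k *s x = (?f ^^ n) (k *s x')"
      using c V(1) by (subst ad_funpow_scale) auto
    then show "k *s x \<in> I n" unfolding I_def using x V(2) by (auto simp: subspace_scale)
  qed
  have anti: "I (m + n) \<subseteq> I m" for m n
    unfolding I_def using fV by (auto simp: funpow_add)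
  have IL: "I n \<subseteq> L" for n unfolding I_def using fV V(1) by blast
  obtain n where n: "\<And>m. dim (I n) \<le> dim (I m)"
    using ex_has_least_nat[of "\<lambda>_. True" 0 "\<lambda>n. dim (I n)"] by blast
  have stab: "I (n + m) = I n" for m
  proof (rule ccontr)
    assume "I (n + m) \<noteq> I n"
    then have "dim (I (n + m)) < dim (I n)"
      using anti[of n m] subI IL by (intro dim_strict_mono_L) auto
    then show False using n[of "n + m"] by simp
  qed
  \<comment> \<open>Two more than the stable index, which leaves the two outer brackets visible in
    \<open>ww\<close>.\<close>
  define N where "N = n + 2"
  have "(?f ^^ N) v \<in> I (N + N)"
    using stab[of "2 + N"] stab[of 2] v unfolding N_def by (auto simp: I_def add.assoc)
  then obtain w where w: "w \<in> V" "(?f ^^ N) v = (?f ^^ (N + N)) w" unfolding I_def by blast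
  let ?w = "(?f ^^ n) w"
  have ww: "?f (?f ?w) = (?f ^^ N) w" by (simp add: N_def)
  have "(?f ^^ N) (v - (?f ^^ N) w) = (?f ^^ N) v - (?f ^^ N) ((?f ^^ N) w)"
    using c v fV[OF w(1)] V(1) by (intro ad_funpow_diff) auto
  then have "(?f ^^ N) (v - ?f (?f ?w)) = 0"
    using w by (simp add: ww funpow_add)
  then show thesis using that[of ?w N] fV w by blast
qed

text \<open>\<open>B\<close> is chosen stable and of least dimension above \<open>A\<close>, so that
  \<open>B / A\<close> is a chief factor. A common eigenvector of \<open>V\<close> in
  \<open>B / A\<close> gives the required line.\<close>

lemma ideal_extension:
  assumes "solvable" and V: "restricted_subalgebra V"
    and flags: "\<And>K. restricted_subalgebra K \<Longrightarrow> K \<subset> V \<Longrightarrow> flag K {0} V"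
    and A: "subspace A" "stable V A" "A \<subset> V"
  shows "\<exists>x\<in>V - A. stable V (span (insert x A))"
proof -
  note Vs = restricted_subalgebraD[OF V]
  have VL: "v \<in> L" if "v \<in> V" for v using that Vs(1) by blast
  have A0: "0 \<in> A" using A(1) by (rule subspace_0)
  let ?P = "\<lambda>B. subspace B \<and> stable V B \<and> A \<subset> B \<and> B \<subseteq> V"
  have "?P V" using Vs A by blast
  then obtain B where "?P B" and least: "\<And>X. ?P X \<Longrightarrow> dim B \<le> dim X"
    using ex_has_least_nat[of ?P V dim] by auto
  then have B: "subspace B" "stable V B" "A \<subset> B" "B \<subseteq> V" by auto
  have BV: "d \<in> V" if "d \<in> B" for d using that B(4) by blast
  have minimal: "X = B"
    if "subspace X" "stable V X" "A \<subseteq> X" "X \<subseteq> B" "d \<in> X" "d \<notin> A" for X d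
  proof (rule ccontr)
    assume "X \<noteq> B"
    then have "dim X < dim B"
      using that B VL by (intro dim_strict_mono_L) auto
    moreover have "dim B \<le> dim X" using that B by (intro least) blast
    ultimately show False by simp
  qed
  \<comment> \<open>The part of \<open>B\<close> that \<open>S\<close> sends into \<open>A\<close>
    is \<open>V\<close>-stable by the closure condition on \<open>S\<close>. By minimality, a single
    vector outside \<open>A\<close> killed by \<open>S\<close> modulo \<open>A\<close> forces
    \<open>S\<close> to kill all of \<open>B / A\<close>.\<close>
  have annihilated: "bracket s d \<in> A"
    if S: "S \<subseteq> V" "\<And>s v d. s \<in> S \<Longrightarrow> v \<in> V \<Longrightarrow> d \<in> B \<Longrightarrow> (\<forall>s\<in>S. bracket s d \<in> A) \<Longrightarrow>
        bracket (bracket v s) d \<in> A"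
      and b: "b \<in> B" "b \<notin> A" "\<And>s. s \<in> S \<Longrightarrow> bracket s b \<in> A" and sd: "s \<in> S" "d \<in> B"
    for S b s d
  proof -
    let ?X = "{d \<in> B. \<forall>s\<in>S. bracket s d \<in> A}"
    have SL: "s \<in> L" if "s \<in> S" for s using that S(1) VL by blast
    have "subspace ?X"
      using B(1) A(1) SL BV VL
      by (intro subspaceI)
        (auto simp: subspace_0 subspace_add subspace_scale bracket_add_right bracket_scale_right)
    moreover have "stable V ?X"
      unfolding stable_def
    proof (intro ballI)
      fix v d assume v: "v \<in> V" and d: "d \<in> ?X"
      have "bracket s (bracket v d) \<in> A" if s: "s \<in> S" for s
      proof -
        have "bracket s (bracket v d) = bracket v (bracket s d) - bracket (bracket v s) d"
          using bracket_leibniz[of v s d] v d BV VL SL[OF s] by auto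
        moreover have "bracket v (bracket s d) \<in> A" using d s v A(2) by (auto intro: stableD)
        moreover have "bracket (bracket v s) d \<in> A" using S(2)[OF s v] d by blast
        ultimately show ?thesis using A(1) by (simp add: subspace_diff)
      qed
      then show "bracket v d \<in> ?X" using B(2) v d by (auto intro: stableD)
    qed
    moreover have "A \<subseteq> ?X" using A(2) B(3) S(1) by (auto intro: stableD)
    ultimately have "?X = B" using b by (intro minimal[of ?X b]) auto
    then show ?thesis using sd by blast
  qed
  have "V \<noteq> {0}" using A(3) A0 by blast
  then obtain M where M: "maximal_in M V" and VVM: "\<And>v w. v \<in> V \<Longrightarrow> w \<in> V \<Longrightarrow> bracket v w \<in> M"
    using exists_codim_one[OF assms(1) V] by blast
  note MV = maximal_inD(3)[OF M]
  have MinV: "m \<in> V" if "m \<in> M" for m using that MV by blast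
  have "flag M {0} V" using flags maximal_inD(1)[OF M] MV by blast
  moreover have "stable M B" using B(2) MinV by (auto simp: stable_def)
  moreover have "\<not> B \<inter> V \<subseteq> A" using B(3,4) by blast
  \<comment> \<open>\<open>M\<close> is proper, hence triangular on \<open>V\<close>, and so has a
    common eigenvector in \<open>B / A\<close>.\<close>
  ultimately have "\<exists>b\<in>B - A. \<forall>m\<in>M. \<exists>\<mu>. bracket m b - \<mu> *s b \<in> A"
    using A(1) A0 B(1) by (intro flag_common_eigenvector_mod[of M "{0}" V]) auto
  then obtain b where b: "b \<in> B" "b \<notin> A" and eig: "\<And>m. m \<in> M \<Longrightarrow> \<exists>\<mu>. bracket m b - \<mu> *s b \<in> A"
    by blast
  have bV: "b \<in> V" and bL: "b \<in> L" using b BV VL by auto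
  have AL: "A \<subseteq> L" using A(3) VL by blast
  have stA: "stable F A" if "F \<subseteq> V" for F using A(2) that by (auto simp: stable_def)
  have MM: "bracket (bracket m m') d \<in> A" if m: "m \<in> M" "m' \<in> M" and d: "d \<in> B" for m m' d
  proof (rule annihilated[of "{bracket m m' | m m'. m \<in> M \<and> m' \<in> M}" b])
    let ?S = "{bracket m m' | m m'. m \<in> M \<and> m' \<in> M}"
    show "?S \<subseteq> V" using Vs(3) MinV by blast
    show "bracket (bracket v s) d \<in> A"
      if s: "s \<in> ?S" and v: "v \<in> V" and d: "d \<in> B" and ann: "\<forall>s\<in>?S. bracket s d \<in> A" for s v d
    proof -
      obtain m m' where m: "m \<in> M" "m' \<in> M" "s = bracket m m'" using s by blast
      have vm: "bracket v m \<in> M" "bracket v m' \<in> M" using VVM v m MinV by auto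
      have "bracket (bracket v s) d = bracket (bracket (bracket v m) m') d + bracket (bracket m (bracket v m')) d"
        using m v d vm VL MinV BV bracket_leibniz[of v m m']
        by (simp add: bracket_add_left bracket_closed)
      moreover have "bracket (bracket (bracket v m) m') d \<in> A" "bracket (bracket m (bracket v m')) d \<in> A"
        using ann vm m by blast+
      ultimately show ?thesis using A(1) by (simp add: subspace_add)
    qed
    show "bracket s b \<in> A" if "s \<in> ?S" for s
    proof -
      obtain m m' where m: "m \<in> M" "m' \<in> M" "s = bracket m m'" using \<open>s \<in> ?S\<close> by blast
      obtain \<alpha> \<beta> where "bracket m b - \<alpha> *s b \<in> A" "bracket m' b - \<beta> *s b \<in> A"
        using eig m by blast
      then show ?thesis
        unfolding m(3) using m MinV VL bL AL A(1)
        by (intro bracket_common_eigenvector_mod) (auto intro: stA)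
    qed
  qed (use b m d in auto)
  show ?thesis
  \<comment> \<open>In the first case \<open>V\<close> acts on \<open>B / A\<close> by commuting
    operators; the second case is contradictory.\<close>
  proof (cases "\<forall>v\<in>V. \<forall>w\<in>V. bracket (bracket v w) b \<in> A")
    case True
    have VV: "bracket (bracket v w) d \<in> A" if v: "v \<in> V" "w \<in> V" and d: "d \<in> B" for v w d
      by (rule annihilated[of "{bracket v w | v w. v \<in> V \<and> w \<in> V}" b])
        (use True b v d Vs(3) in \<open>blast+\<close>)
    have scalar: "\<exists>\<mu>. bracket v b - \<mu> *s b \<in> A" if v: "v \<in> V" for v
    proof -
      obtain T where T: "finite T" "span T = L" by (rule finite_spanning_set)
      obtain z \<mu> where z: "z \<in> B" "z \<notin> A" "bracket v z - \<mu> *s z \<in> A"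
      proof (rule semilinear_eigenvector_mod[of T B A "bracket v" "\<lambda>a. a"])
        show "\<exists>\<mu> c. (\<exists>i\<le>m. c i \<noteq> 0) \<and> (\<forall>i\<le>m. (case i of 0 \<Rightarrow> 0 | Suc j \<Rightarrow> c j) +
          c m * a i = \<mu> * c i)" for m and a :: "nat \<Rightarrow> 'k"
          by (rule linear_eigen_coeffs)
        show "bracket v (x + y) - (bracket v x + bracket v y) \<in> A" if "x \<in> B" "y \<in> B" for x y
          using that v VL BV A0 by (simp add: bracket_add_right)
        show "bracket v (a *s x) = a *s bracket v x" if "x \<in> B" for a x
          using that v VL BV by (simp add: bracket_scale_right)
      qed (use T B A v BV VL in \<open>auto intro: stableD\<close>)
      \<comment> \<open>Schur's lemma: \<open>VV\<close> makes \<open>v\<close> commute with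
        \<open>V\<close> on \<open>B / A\<close>, so its eigenspace is stable and hence all of
        \<open>B\<close>; in particular it contains \<open>b\<close>.\<close>
      let ?X = "{d \<in> B. bracket v d - \<mu> *s d \<in> A}"
      have "subspace ?X"
      proof (rule subspaceI)
        show "0 \<in> ?X" using B(1) v VL A0 by (simp add: subspace_0)
      next
        fix x y assume xy: "x \<in> ?X" "y \<in> ?X"
        then have "bracket v (x + y) - \<mu> *s (x + y) =
            (bracket v x - \<mu> *s x) + (bracket v y - \<mu> *s y)"
          using v VL BV by (simp add: bracket_add_right scale_right_distrib)
        also have "\<dots> \<in> A" using xy A(1) by (simp add: subspace_add)
        finally show "x + y \<in> ?X" using xy B(1) by (simp add: subspace_add)
      next
        fix k x assume x: "x \<in> ?X"
        then have "bracket v (k *s x) - \<mu> *s k *s x = k *s (bracket v x - \<mu> *s x)"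
          using v VL BV
          by (simp add: bracket_scale_right scale_right_diff_distrib scale_left_commute)
        also have "\<dots> \<in> A" using x A(1) by (simp add: subspace_scale)
        finally show "k *s x \<in> ?X" using x B(1) by (simp add: subspace_scale)
      qed
      moreover have "stable V ?X"
        unfolding stable_def
      proof (intro ballI)
        fix w d assume w: "w \<in> V" and d: "d \<in> ?X"
        have dL: "d \<in> L" using d BV VL by blast
        have "bracket v (bracket w d) - \<mu> *s bracket w d
            = bracket (bracket v w) d + bracket w (bracket v d - \<mu> *s d)"
          using bracket_leibniz[of v w d] v w dL VL subspace_scale[OF subspace_L dL, of \<mu>]
          by (simp add: bracket_diff_right bracket_closed bracket_scale_right)
        also have "\<dots> \<in> A"
          using d by (intro subspace_add[OF A(1)] VV[OF v w] stableD[OF A(2) w]) auto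
        finally show "bracket w d \<in> ?X" using d w B(2) by (auto intro: stableD)
      qed
      moreover have "A \<subseteq> ?X"
        using B(3) subspace_diff[OF A(1) stableD[OF A(2) v] subspace_scale[OF A(1)]] by blast
      ultimately have "?X = B" using z by (intro minimal[of ?X z]) auto
      then show ?thesis using b by blast
    qed
    have "stable V (span (insert b A))"
      unfolding stable_def
    proof (intro ballI)
      fix v d assume v: "v \<in> V" and "d \<in> span (insert b A)"
      then obtain k where k: "d - k *s b \<in> A" unfolding mem_span_insert_subspace[OF A(1)] by blast
      obtain \<mu> where \<mu>: "bracket v b - \<mu> *s b \<in> A" using scalar[OF v] by blast
      have kL: "d - k *s b \<in> L" "k *s b \<in> L" using k AL bL subspace_scale[OF subspace_L] by auto
      have "bracket v ((d - k *s b) + k *s b) = bracket v (d - k *s b) + k *s bracket v b"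
        using kL VL[OF v] bL by (subst bracket_add_right) (auto simp: bracket_scale_right)
      then have "bracket v d - (k * \<mu>) *s b = bracket v (d - k *s b) + k *s (bracket v b - \<mu> *s b)"
        by (simp add: scale_right_diff_distrib)
      also have "\<dots> \<in> A"
        by (rule subspace_add[OF A(1) stableD[OF A(2) v k] subspace_scale[OF A(1) \<mu>]])
      finally show "bracket v d \<in> span (insert b A)"
        unfolding mem_span_insert_subspace[OF A(1)] by blast
    qed
    then show ?thesis using b bV by blast
  next
    case False
    then obtain v w where v: "v \<in> V" and w: "w \<in> V" and nz: "bracket (bracket v w) b \<notin> A" by blast
    define c where "c = bracket v w"
    have cM: "c \<in> M" and cV: "c \<in> V" and cL: "c \<in> L"
      using VVM v w MinV VL by (auto simp: c_def)
    obtain \<mu> where \<mu>: "bracket c b - \<mu> *s b \<in> A" using eig[OF cM] by blast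
    have \<mu>0: "\<mu> \<noteq> 0" using \<mu> nz by (auto simp: c_def)
    \<comment> \<open>Modulo \<open>A\<close> the \<open>n\<close>-th power acts on \<open>b\<close>
      by \<open>\<mu> ^ n\<close>, which is nonzero.\<close>
    have not_nil: "(bracket c ^^ n) b \<notin> A" for n
    proof
      have pow: "(bracket c ^^ n) b - \<mu> ^ n *s b \<in> A"
      proof (induction n)
        case (Suc n)
        let ?u = "(bracket c ^^ n) b"
        have uL: "?u \<in> L" "\<mu> ^ n *s b \<in> L"
          using cL bL ad_funpow_closed subspace_scale[OF subspace_L] by auto
        have "bracket c ?u - \<mu> ^ Suc n *s b
            = bracket c (?u - \<mu> ^ n *s b) + \<mu> ^ n *s (bracket c b - \<mu> *s b)"
          using cL uL bL
          by (simp add: bracket_diff_right bracket_scale_right scale_right_diff_distrib mult.commute)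
        also have "\<dots> \<in> A"
          by (rule subspace_add[OF A(1) stableD[OF A(2) cV Suc] subspace_scale[OF A(1) \<mu>]])
        finally show ?case by simp
      qed (simp add: A0)
      assume "(bracket c ^^ n) b \<in> A"
      then have "\<mu> ^ n *s b \<in> A" using subspace_diff[OF A(1) _ pow] by fastforce
      then have "inverse (\<mu> ^ n) *s \<mu> ^ n *s b \<in> A"
        by (rule subspace_scale[OF A(1)])
      then show False using \<mu>0 b by simp
    qed
    define K where "K = {u \<in> V. \<exists>n. (bracket c ^^ n) u = 0}"
    have K: "restricted_subalgebra K"
      unfolding K_def using V cV by (rule restricted_subalgebra_fitting_null)
    \<comment> \<open>This makes the Fitting null component proper, so that it acts triangularly on
      \<open>V\<close>.\<close>
    have "b \<notin> K" using not_nil A0 by (auto simp: K_def) metis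
    then have KV: "K \<subset> V" using bV by (auto simp: K_def)
    have flagK: "flag K {0} V" using flags K KV by blast
    \<comment> \<open>\<open>u\<close> differs from an element of \<open>K\<close> by
      \<open>[c, [c, x]]\<close>, a commutator of elements of \<open>M\<close>, which
      \<open>MM\<close> kills on \<open>B / A\<close>.\<close>
    have split: "\<exists>u'\<in>K. \<forall>d\<in>B. bracket (u - u') d \<in> A" if u: "u \<in> V" for u
    proof -
      obtain x n where x: "x \<in> V" "(bracket c ^^ n) (u - bracket c (bracket c x)) = 0"
        using fitting_decomposition[OF cL Vs(1,2) _ u] Vs(3) cV by blast
      have cx: "bracket c x \<in> M" using VVM cV x(1) by blast
      then have "u - bracket c (bracket c x) \<in> K"
        using x u cV MinV Vs(2,3) by (auto simp: K_def subspace_diff)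
      moreover have "\<forall>d\<in>B. bracket (u - (u - bracket c (bracket c x))) d \<in> A"
        using MM[OF cM cx] by simp
      ultimately show ?thesis by blast
    qed
    obtain v' where v': "v' \<in> K" "\<And>d. d \<in> B \<Longrightarrow> bracket (v - v') d \<in> A" using split[OF v] by blast
    obtain w' where w': "w' \<in> K" "\<And>d. d \<in> B \<Longrightarrow> bracket (w - w') d \<in> A" using split[OF w] by blast
    define c' where "c' = bracket v' w'"
    have KinV: "u \<in> V" if "u \<in> K" for u using that KV by blast
    have vw': "v' \<in> V" "w' \<in> V" "v' \<in> L" "w' \<in> L" using v' w' KinV VL by auto
    have c'V: "c' \<in> V" and c'L: "c' \<in> L" using vw' Vs(3) VL by (auto simp: c'_def)
    have BL: "d \<in> L" if "d \<in> B" for d using that BV VL by blast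
    have diff: "bracket c d - bracket c' d \<in> A" if d: "d \<in> B" for d
    proof -
      have vB: "bracket u d \<in> B" if "u \<in> V" for u using that d B(2) by (auto intro: stableD)
      have L: "v \<in> L" "w \<in> L" "d \<in> L" "v - v' \<in> L" "w - w' \<in> L"
        using v w d VL BL vw' subspace_diff[OF subspace_L] by auto
      have 1: "bracket (bracket x y) d = bracket x (bracket y d) - bracket y (bracket x d)"
        if "x \<in> L" "y \<in> L" for x y
        using bracket_leibniz[of x y d] that L by simp
      \<comment> \<open>First \<open>v\<close> is replaced by \<open>v'\<close>, then
        \<open>w\<close> by \<open>w'\<close>; each difference sends \<open>B\<close> into
        \<open>A\<close>.\<close>
      have "bracket c d - bracket c' d
          = (bracket (v - v') (bracket w d) - bracket w (bracket (v - v') d))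
          + (bracket v' (bracket (w - w') d) - bracket (w - w') (bracket v' d))"
        unfolding c_def c'_def using L vw'
        by (simp add: 1 bracket_diff_left bracket_diff_right bracket_closed)
      also have "\<dots> \<in> A"
        using subspace_diff[OF Vs(2) w vw'(2)]
        by (intro subspace_add[OF A(1) subspace_diff[OF A(1)] subspace_diff[OF A(1)]]
            v'(2) stableD[OF A(2)] w w'(2) d vB vw')
      finally show ?thesis .
    qed
    have KL: "K \<subseteq> L" using KinV VL by blast
    moreover have "stable K {0}" using KL by (auto simp: stable_def)
    \<comment> \<open>\<open>c'\<close> is a commutator inside \<open>K\<close>, hence nilpotent on
      \<open>V\<close>; \<open>close\<close> carries this over to \<open>c\<close> at
      \<open>b\<close>, against \<open>not_nil\<close>.\<close>
    ultimately have "\<exists>n. \<forall>d\<in>V. (bracket c' ^^ n) d \<in> {0}"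
      unfolding c'_def using zero_in_L v'(1) w'(1)
      by (intro flag_commutator_nilpotent[OF flagK]) auto
    then obtain n where n: "\<forall>d\<in>V. (bracket c' ^^ n) d \<in> {0}" by blast
    have close: "(bracket c ^^ n) b - (bracket c' ^^ n) b \<in> A" for n
    proof (induction n)
      case (Suc n)
      let ?x = "(bracket c ^^ n) b" and ?y = "(bracket c' ^^ n) b"
      have yB: "?y \<in> B" using b(1) c'V B(2) by (induction n) (auto intro: stableD)
      have L: "?x \<in> L" "?y \<in> L" using cL c'L bL ad_funpow_closed by auto
      have "bracket c ?x - bracket c' ?y = bracket c (?x - ?y) + (bracket c ?y - bracket c' ?y)"
        using L cL c'L by (simp add: bracket_diff_right)
      also have "\<dots> \<in> A"
        by (rule subspace_add[OF A(1) stableD[OF A(2) cV Suc] diff[OF yB]])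
      finally show ?case by simp
    qed (simp add: A0)
    have "(bracket c' ^^ n) b = 0" using n bV by blast
    then show ?thesis using close[of n] not_nil[of n] by simp
  qed
qed

text \<open>Maximal steps from \<open>U\<close> upwards adjoin one vector at a time, and every
  member is a subalgebra containing \<open>U\<close>, hence \<open>U\<close>-stable.\<close>

lemma flag_of_codim_one:
  assumes "codim_one" "restricted_subalgebra U" "restricted_subalgebra V" "U \<subseteq> V"
  shows "flag U U V"
  using assms(3,4)
proof (induction "dim V" arbitrary: V rule: less_induct)
  case less
  show ?case
  proof (cases "U = V")
    case True
    then show ?thesis by (simp add: flag_refl)
  next
    case False
    then obtain M where M: "maximal_in M V" "U \<subseteq> M"
      using exists_maximal_above[OF assms(2) less.prems(1)] less.prems(2) by blast
    note Ms = restricted_subalgebraD[OF maximal_inD(1)[OF M(1)]]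
      and Vs = restricted_subalgebraD[OF less.prems(1)]
    have dimV: "dim V = Suc (dim M)" using M(1) assms(1) by (simp add: codim_one_def)
    then have fM: "flag U U M" using less.hyps M maximal_inD(1) by simp
    obtain x where x: "x \<in> V" "x \<notin> M" using maximal_inD(3)[OF M(1)] by blast
    have "V = span (insert x M)"
      using x dimV Vs Ms maximal_inD(3)[OF M(1)] by (intro span_insert_codim_one) auto
    moreover have "stable U V" using less.prems(2) Vs(3) by (auto simp: stable_def)
    ultimately show ?thesis using flag_step[OF fM, of x] x Vs(1) by auto
  qed
qed

text \<open>By induction a proper \<open>K\<close> has a flag of its own ideals; continued by the
  steps from \<open>K\<close> to \<open>V\<close> it gives the triangular action that
  \<open>ideal_extension\<close> requires. A flag of largest dimension therefore cannot stop below
  \<open>V\<close>.\<close>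

lemma flag_of_ideals:
  assumes "solvable" "codim_one" "restricted_subalgebra V"
  shows "flag V {0} V"
  using assms(3)
proof (induction "dim V" arbitrary: V rule: less_induct)
  case less
  note Vs = restricted_subalgebraD[OF less.prems]
  have flags: "flag K {0} V" if K: "restricted_subalgebra K" "K \<subset> V" for K
  proof -
    have "dim K < dim V"
      using K Vs restricted_subalgebraD(2) by (intro dim_strict_mono_L) auto
    then have "flag K {0} K" using less.hyps K by blast
    moreover have "flag K K V" using K less.prems assms(2) by (intro flag_of_codim_one) auto
    ultimately show ?thesis using flag_trans by blast
  qed
  let ?P = "\<lambda>A. flag V {0} A \<and> A \<subseteq> V"
  have "?P {0}" using Vs(5) flag_refl by simp
  moreover have "\<forall>A. ?P A \<longrightarrow> dim A < Suc (dim V)"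
    using dim_mono_L Vs(1) by (auto simp: less_Suc_eq_le)
  ultimately obtain A where A: "flag V {0} A" "A \<subseteq> V" and most: "\<And>X. ?P X \<Longrightarrow> dim X \<le> dim A"
    using ex_has_greatest_nat[of ?P "{0}" dim "Suc (dim V)"] by auto
  have sA: "subspace A" "stable V A"
  proof -
    have "stable V {0}" using Vs(1) by (auto simp: stable_def)
    then show "subspace A" "stable V A"
      using flag_subspace[OF A(1)] flag_stable[OF A(1)] by auto
  qed
  have "A = V"
  proof (rule ccontr)
    assume "A \<noteq> V"
    then obtain x where x: "x \<in> V" "x \<notin> A" "stable V (span (insert x A))"
      using ideal_extension[OF assms(1) less.prems flags sA] A(2) by blast
    then have "flag V {0} (span (insert x A))"
      using A(1) Vs(1) by (intro flag_step) auto
    moreover have "span (insert x A) \<subseteq> V" using x A(2) Vs(2) by (simp add: span_insert_subset)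
    ultimately have "dim (span (insert x A)) \<le> dim A" using most by blast
    moreover have "dim (span (insert x A)) = Suc (dim A)"
      using x A(2) Vs(1) sA(1) by (intro dim_span_insert_L) auto
    ultimately show False by simp
  qed
  then show ?case using A(1) by simp
qed

section \<open>From flags to chains indexed by dimension\<close>

lemma flag_chain:
  assumes "flag F {0} B" "F \<subseteq> L"
  shows "\<exists>C. C 0 = {0} \<and> C (dim B) = B \<and>
    (\<forall>j\<le>dim B. subspace (C j) \<and> C j \<subseteq> L \<and> stable F (C j) \<and> dim (C j) = j) \<and>
    (\<forall>j<dim B. C j \<subset> C (Suc j))"
  using assms(1)
proof (induction rule: flag.induct)
  case flag_refl
  show ?case
    using assms(2) zero_in_L by (intro exI[of _ "\<lambda>_. {0}"]) (auto simp: dim_zero stable_def)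
next
  case (flag_step B x)
  let ?B = "span (insert x B)"
  obtain C where C: "C 0 = {0}" "C (dim B) = B"
    "\<And>j. j \<le> dim B \<Longrightarrow> subspace (C j) \<and> C j \<subseteq> L \<and> stable F (C j) \<and> dim (C j) = j"
    "\<And>j. j < dim B \<Longrightarrow> C j \<subset> C (Suc j)"
    using flag_step.IH by blast
  have B: "subspace B" "B \<subseteq> L" using C(2) C(3)[of "dim B"] by auto
  have d: "dim ?B = Suc (dim B)"
    using flag_step.hyps(2,3) B by (intro dim_span_insert_L)
  have BB: "B \<subset> ?B" using flag_step.hyps(3) span_superset[of "insert x B"] by blast
  have BL: "?B \<subseteq> L" using flag_step.hyps(2) B(2) subspace_L by (simp add: span_insert_subset)
  have new: "subspace ?B \<and> ?B \<subseteq> L \<and> stable F ?B \<and> dim ?B = Suc (dim B)"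
    using BL flag_step.hyps(4) d by blast
  let ?C = "C(Suc (dim B) := ?B)"
  have "subspace (?C j) \<and> ?C j \<subseteq> L \<and> stable F (?C j) \<and> dim (?C j) = j" if "j \<le> Suc (dim B)" for j
    using that C(3)[of j] new by (cases "j = Suc (dim B)") auto
  moreover have "?C j \<subset> ?C (Suc j)" if "j < Suc (dim B)" for j
    using that C(4)[of j] C(2) BB by (cases "j = dim B") auto
  moreover have "?C 0 = {0}" "?C (Suc (dim B)) = ?B" using C(1) by auto
  ultimately show ?case unfolding d by blast
qed

lemma codim_one_imp_supersolvable:
  assumes "solvable" "codim_one"
  shows "supersolvable"
proof -
  obtain C where C: "C 0 = {0}" "C (dim L) = L"
    "\<forall>j\<le>dim L. subspace (C j) \<and> C j \<subseteq> L \<and> stable L (C j) \<and> dim (C j) = j"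
    "\<forall>j<dim L. C j \<subset> C (Suc j)"
    using flag_chain[OF flag_of_ideals[OF assms restricted_subalgebra_L] order_refl] by blast
  then have "ideal (C j) \<and> dim (C j) = j" if "j \<le> dim L" for j
    using that by (simp add: ideal_def stable_def)
  then show ?thesis
    unfolding supersolvable_def using C by blast
qed

end

theorem proposition5p2:
  fixes scale :: "'k::alg_closed_field \<Rightarrow> 'v::ab_group_add \<Rightarrow> 'v"
    and L :: "'v set"
    and bracket :: "'v \<Rightarrow> 'v \<Rightarrow> 'v"
    and pmap :: "'v \<Rightarrow> 'v"
  assumes "CHAR('k) > 0"
    and "restricted_lie_algebra scale L bracket pmap"
    and "lie_algebra.finite_dimensional scale L"
    and "lie_algebra.solvable scale L bracket"
  shows "(restricted_lie_algebra.lower_semimodular scale L bracket pmap \<longleftrightarrow>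
            restricted_lie_algebra.J_algebra scale L bracket pmap)
       \<and> (restricted_lie_algebra.J_algebra scale L bracket pmap \<longleftrightarrow>
            lie_algebra.supersolvable scale L bracket)"
proof -
  interpret restricted_lie_algebra scale L bracket pmap by fact
  interpret fd_restricted_lie_algebra scale L bracket pmap
    by unfold_locales fact
  have "lower_semimodular \<longleftrightarrow> codim_one" "J_algebra \<longleftrightarrow> codim_one" "supersolvable \<longleftrightarrow> codim_one"
    using lower_semimodular_imp_codim_one J_algebra_imp_codim_one supersolvable_imp_codim_one
      codim_one_imp_lower_semimodular codim_one_imp_J_algebra codim_one_imp_supersolvable assms(4)
    by blast+
  then show ?thesis by simp
qed

end
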